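(* Let $F=\alpha^{1+m}\beta^{-m}$, $m\neq 0$, be an $m$-Kropina metric of Berwald type on a smooth manifold $M$ with $\dim M>2$, built from a (pseudo-)Riemannian metric $a=a_{ij}\,dx^i dx^j$ and a 1-form $b=b_i\,dx^i$, and let $f=f_i\,dx^i$ be the 1-form appearing in the Berwald condition $$\mathring\nabla_j b_i = m (f_k b^k)a_{ij} + b_i f_j - m f_i b_j .$$ Then the following are equivalent: (i) $F$ is locally metrizable; (ii) the affine Ricci tensor of $F$ is symmetric, $\bar R_{ij}=\bar R_{ji}$; (iii) the 1-form $f$ is closed. In this case one can locally (on a neighborhood of each point of $M$) write $f_i=\partial_i\psi$ for some smooth function $\psi$, and for any such $\psi$, setting $\tilde a_{ij}=e^{-2m\psi}a_{ij}$, $\tilde b_i=e^{-(1+m)\psi}b_i$, $\tilde\alpha=\sqrt{|\tilde a_{ij}y^iy^j|}$, $\tilde\beta=\tilde b_iy^i$, the following hold on that neighborhood: - $F=\tilde\alpha^{1+m}\tilde\beta^{-m}$; - $\tilde b$ is parallel with respect to the Levi-Civita connection of $\tilde a$; - $\tilde a$ is a local metrization of $F$, i.e. the Levi-Civita connection of $\tilde a$ coincides with the affine connection of $F$.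
   Context: Finsler metrics. Let $M$ be a smooth manifold of dimension $n$, with local coordinates $x^i$ and induced coordinates $(x,y)$ on $TM$ (a tangent vector is $y^i\partial_i$); write $\partial_i=\partial/\partial x^i$, $\bar\partial_i=\partial/\partial y^i$. A conic subbundle of $TM$ is an open subset $\mathcal A\subset TM$ such that $(x,\lambda y)\in\mathcal A$ for all $(x,y)\in\mathcal A$, $\lambda>0$, and whose projection to $M$ is all of $M$. A Finsler metric on $\mathcal A$ is a smooth map $F:\mathcal A\to[0,\infty)$ with $F(x,\lambda y)=\lambda F(x,y)$ for $\lambda>0$ and with nondegenerate fundamental tensor $g_{ij}=\bar\partial_i\bar\partial_j(\tfrac12F^2)$. Berwald metrics. The canonical nonlinear connection has coefficients $N^j_i=\tfrac14\bar\partial_i\big[g^{jk}(y^l\partial_l\bar\partial_kF^2-\partial_kF^2)\big]$. $F$ is of Berwald type if $N^k_i=\Gamma^k_{ij}(x)y^j$ for functions $\Gamma^k_{ij}$ on the base; these are then the Christoffel symbols of a torsion-free affine connection on $M$, called the affine connection of $F$. The affine Ricci tensor is $\bar R_{lk}=\bar R^i{}_{lik}$, with $\bar R^k{}_{\ell ij}=\partial_i\Gamma^k_{j\ell}-\partial_j\Gamma^k_{i\ell}+\Gamma^k_{im}\Gamma^m_{j\ell}-\Gamma^k_{jm}\Gamma^m_{i\ell}$. Metrizability. A Berwald metric $F$ is locally metrizable if each point of $M$ has a neighborhood admitting a pseudo-Riemannian metric whose Levi-Civita connection is the restriction of the affine connection of $F$ (such a metric is a local metrization). $m$-Kropina metrics.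 An $m$-Kropina metric is a Finsler metric of the form $F=\alpha^{1+m}\beta^{-m}$ with $\alpha=\sqrt{|a_{ij}y^iy^j|}$, $\beta=b_iy^i$, where $a$ is a (pseudo-)Riemannian metric of arbitrary signature and $b$ a 1-form on $M$, and $m\in\mathbb R$; $b$ is then nowhere vanishing. The trivial case $m=0$ is excluded. Indices are raised and lowered with $a_{ij}$, and $\mathring\nabla$, $\mathring\Gamma$ denote the Levi-Civita connection of $a$ and its Christoffel symbols. Known fact defining $f$: for $n>2$, $F$ is of Berwald type iff there is a smooth vector field $f^i$ on $M$ with $\mathring\nabla_j b_i = m (f_k b^k)a_{ij} + b_i f_j - m f_i b_j$. In that case $f$ is unique and the affine connection of $F$ is $\Gamma^\ell_{ij}=\mathring\Gamma^\ell_{ij}+m a^{\ell k}(a_{ij}f_k-a_{jk}f_i-a_{ki}f_j)$. *)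

theory Defs
  imports "HOL-Analysis.Analysis"
begin

section \<open>Smooth maps on open subsets of Euclidean spaces\<close>

(* Only used for open S, so that the full derivative (not one relative to S) is the right one. *)
primrec Ck_on :: "nat \<Rightarrow> 'a::euclidean_space set \<Rightarrow> ('a \<Rightarrow> 'b::real_normed_vector) \<Rightarrow> bool" where
  "Ck_on 0 S h \<longleftrightarrow> continuous_on S h"
| "Ck_on (Suc k) S h \<longleftrightarrow>
     (\<forall>x\<in>S. h differentiable (at x)) \<and> (\<forall>v. Ck_on k S (\<lambda>x. frechet_derivative h (at x) v))"

definition smooth_on :: "'a::euclidean_space set \<Rightarrow> ('a \<Rightarrow> 'b::real_normed_vector) \<Rightarrow> bool" where
  "smooth_on S h \<longleftrightarrow> (\<forall>k. Ck_on k S h)"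

definition partial :: "'n \<Rightarrow> (real^'n \<Rightarrow> real) \<Rightarrow> real^'n \<Rightarrow> real" where
  "partial i h x = frechet_derivative h (at x) (axis i 1)"


section \<open>Smooth manifolds and their tangent bundle\<close>

(* A manifold is a Hausdorff second countable type 'p with a smooth atlas; its dimension is
   CARD('n). A chart is a pair (U, phi), where the values of phi outside U are irrelevant.
   The atlas need not be maximal: all notions below are independent of the atlas chosen
   within a smooth structure. *)
type_synonym ('p, 'n) chart = "'p set \<times> ('p \<Rightarrow> real^'n)"

definition chart_inv :: "('p, 'n) chart \<Rightarrow> real^'n \<Rightarrow> 'p" where
  "chart_inv c = inv_into (fst c) (snd c)"

definition coord_image :: "('p, 'n) chart \<Rightarrow> 'p set \<Rightarrow> (real^'n) set" where
  "coord_image c U = snd c ` (fst c \<inter> U)"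

definition coord_change :: "('p, 'n) chart \<Rightarrow> ('p, 'n) chart \<Rightarrow> real^'n \<Rightarrow> real^'n" where
  "coord_change c c' = (\<lambda>x. snd c' (chart_inv c x))"

definition smooth_manifold ::
    "('p::{t2_space, second_countable_topology}, 'n::finite) chart set \<Rightarrow> bool" where
  "smooth_manifold M \<longleftrightarrow>
     (\<Union>c\<in>M. fst c) = UNIV \<and>
     (\<forall>c\<in>M. open (fst c) \<and> open (coord_image c UNIV) \<and>
        homeomorphism (fst c) (coord_image c UNIV) (snd c) (chart_inv c)) \<and>
     (\<forall>c\<in>M. \<forall>c'\<in>M. smooth_on (coord_image c (fst c')) (coord_change c c'))"

(* A tangent vector at p is encoded by its components in every chart around p, subject to the
   transformation law; outside these charts it is set to 0 to make the encoding unique. *)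
type_synonym ('p, 'n) tvec = "('p, 'n) chart \<Rightarrow> real^'n"

definition tangent_space ::
    "('p, 'n::finite) chart set \<Rightarrow> 'p \<Rightarrow> ('p, 'n) tvec set" where
  "tangent_space M p = {v.
     (\<forall>c\<in>M. \<forall>c'\<in>M. p \<in> fst c \<inter> fst c' \<longrightarrow>
        v c' = frechet_derivative (coord_change c c') (at (snd c p)) (v c)) \<and>
     (\<forall>c. \<not> (c \<in> M \<and> p \<in> fst c) \<longrightarrow> v c = 0)}"

definition tangent_bundle ::
    "('p, 'n::finite) chart set \<Rightarrow> ('p \<times> ('p, 'n) tvec) set" where
  "tangent_bundle M = {(p, v). v \<in> tangent_space M p}"

(* The tangent vector at the point with coordinates x whose components in the chart c are y. *)
definition coord_vec ::
    "('p, 'n::finite) chart set \<Rightarrow> ('p, 'n) chart \<Rightarrow> real^'n \<Rightarrow> real^'n \<Rightarrow> ('p, 'n) tvec" where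
  "coord_vec M c x y = (\<lambda>c'. if c' \<in> M \<and> chart_inv c x \<in> fst c'
     then frechet_derivative (coord_change c c') (at x) y else 0)"

definition smooth_fun_on ::
    "('p, 'n::finite) chart set \<Rightarrow> 'p set \<Rightarrow> ('p \<Rightarrow> real) \<Rightarrow> bool" where
  "smooth_fun_on M U h \<longleftrightarrow> (\<forall>c\<in>M. smooth_on (coord_image c U) (\<lambda>x. h (chart_inv c x)))"


section \<open>One-forms and pseudo-Riemannian metrics\<close>

definition form_comp :: "('p, 'n::finite) chart set \<Rightarrow> ('p, 'n) chart \<Rightarrow>
    ('p \<Rightarrow> ('p, 'n) tvec \<Rightarrow> real) \<Rightarrow> real^'n \<Rightarrow> real^'n" where
  "form_comp M c b x = (\<chi> i. b (chart_inv c x) (coord_vec M c x (axis i 1)))"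

definition one_form_on :: "('p, 'n::finite) chart set \<Rightarrow> 'p set \<Rightarrow>
    ('p \<Rightarrow> ('p, 'n) tvec \<Rightarrow> real) \<Rightarrow> bool" where
  "one_form_on M U b \<longleftrightarrow>
     (\<forall>p\<in>U. \<forall>u\<in>tangent_space M p. \<forall>v\<in>tangent_space M p. \<forall>s t.
        b p (\<lambda>c. s *\<^sub>R u c + t *\<^sub>R v c) = s * b p u + t * b p v) \<and>
     (\<forall>c\<in>M. \<forall>i. smooth_on (coord_image c U) (\<lambda>x. form_comp M c b x $ i))"

definition metric_comp :: "('p, 'n::finite) chart set \<Rightarrow> ('p, 'n) chart \<Rightarrow>
    ('p \<Rightarrow> ('p, 'n) tvec \<Rightarrow> ('p, 'n) tvec \<Rightarrow> real) \<Rightarrow> real^'n \<Rightarrow> real^'n^'n" where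
  "metric_comp M c a x =
     (\<chi> i j. a (chart_inv c x) (coord_vec M c x (axis i 1)) (coord_vec M c x (axis j 1)))"

(* Arbitrary signature. *)
definition metric_on :: "('p, 'n::finite) chart set \<Rightarrow> 'p set \<Rightarrow>
    ('p \<Rightarrow> ('p, 'n) tvec \<Rightarrow> ('p, 'n) tvec \<Rightarrow> real) \<Rightarrow> bool" where
  "metric_on M U a \<longleftrightarrow>
     (\<forall>p\<in>U. \<forall>u\<in>tangent_space M p. \<forall>v\<in>tangent_space M p. \<forall>w\<in>tangent_space M p. \<forall>s t.
        a p (\<lambda>c. s *\<^sub>R u c + t *\<^sub>R v c) w = s * a p u w + t * a p v w) \<and>
     (\<forall>p\<in>U. \<forall>u\<in>tangent_space M p. \<forall>v\<in>tangent_space M p. a p u v = a p v u) \<and>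
     (\<forall>p\<in>U. \<forall>u\<in>tangent_space M p.
        (\<forall>v\<in>tangent_space M p. a p u v = 0) \<longrightarrow> u = (\<lambda>_. 0)) \<and>
     (\<forall>c\<in>M. \<forall>i j. smooth_on (coord_image c U) (\<lambda>x. metric_comp M c a x $ i $ j))"

definition closed_form :: "('p, 'n::finite) chart set \<Rightarrow>
    ('p \<Rightarrow> ('p, 'n) tvec \<Rightarrow> real) \<Rightarrow> bool" where
  "closed_form M f \<longleftrightarrow> (\<forall>c\<in>M. \<forall>x\<in>coord_image c UNIV. \<forall>i j.
     partial i (\<lambda>z. form_comp M c f z $ j) x = partial j (\<lambda>z. form_comp M c f z $ i) x)"

definition potential_on :: "('p, 'n::finite) chart set \<Rightarrow> 'p set \<Rightarrow>
    ('p \<Rightarrow> ('p, 'n) tvec \<Rightarrow> real) \<Rightarrow> ('p \<Rightarrow> real) \<Rightarrow> bool" where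
  "potential_on M U f \<psi> \<longleftrightarrow> smooth_fun_on M U \<psi> \<and>
     (\<forall>c\<in>M. \<forall>x\<in>coord_image c U. \<forall>i.
        form_comp M c f x $ i = partial i (\<lambda>z. \<psi> (chart_inv c z)) x)"


section \<open>Affine connections in coordinates\<close>

(* Index order of connection coefficients: G x k i j is the coefficient with upper index k and
   lower indices i, j. *)
definition christoffel :: "(real^'n \<Rightarrow> real^'n^'n) \<Rightarrow> real^'n \<Rightarrow> 'n::finite \<Rightarrow> 'n \<Rightarrow> 'n \<Rightarrow> real" where
  "christoffel g x k i j = (\<Sum>l\<in>UNIV. matrix_inv (g x) $ k $ l *
     (partial i (\<lambda>z. g z $ j $ l) x + partial j (\<lambda>z. g z $ i $ l) x
        - partial l (\<lambda>z. g z $ i $ j) x)) / 2"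

(* Component (nabla_j w)_i. *)
definition cov_deriv :: "(real^'n \<Rightarrow> 'n \<Rightarrow> 'n \<Rightarrow> 'n \<Rightarrow> real) \<Rightarrow> (real^'n \<Rightarrow> real^'n) \<Rightarrow>
    real^'n \<Rightarrow> 'n::finite \<Rightarrow> 'n \<Rightarrow> real" where
  "cov_deriv G w x j i = partial j (\<lambda>z. w z $ i) x - (\<Sum>k\<in>UNIV. G x k j i * w x $ k)"

(* curvature G x k l i j has upper index k and lower indices l, i, j, antisymmetric in i, j. *)
definition curvature :: "(real^'n \<Rightarrow> 'n \<Rightarrow> 'n \<Rightarrow> 'n \<Rightarrow> real) \<Rightarrow>
    real^'n \<Rightarrow> 'n::finite \<Rightarrow> 'n \<Rightarrow> 'n \<Rightarrow> 'n \<Rightarrow> real" where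
  "curvature G x k l i j =
     partial i (\<lambda>z. G z k j l) x - partial j (\<lambda>z. G z k i l) x
     + (\<Sum>m\<in>UNIV. G x k i m * G x m j l) - (\<Sum>m\<in>UNIV. G x k j m * G x m i l)"

definition ricci :: "(real^'n \<Rightarrow> 'n \<Rightarrow> 'n \<Rightarrow> 'n \<Rightarrow> real) \<Rightarrow> real^'n \<Rightarrow> 'n::finite \<Rightarrow> 'n \<Rightarrow> real" where
  "ricci G x l k = (\<Sum>i\<in>UNIV. curvature G x i l i k)"


section \<open>Finsler metrics\<close>

(* In this section a local Finsler function is L x y, the value of F at the vector with
   components y at the point with coordinates x. *)
definition fundamental_tensor :: "(real^'n \<Rightarrow> real^'n \<Rightarrow> real) \<Rightarrow> real^'n \<Rightarrow> real^'n \<Rightarrow> real^'n^'n::finite" where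
  "fundamental_tensor L x y =
     (\<chi> i j. partial i (\<lambda>u. partial j (\<lambda>w. (L x w)\<^sup>2 / 2) u) y)"

(* nonlinear_connection L x y j i is the coefficient with upper index j and lower index i. *)
definition nonlinear_connection :: "(real^'n \<Rightarrow> real^'n \<Rightarrow> real) \<Rightarrow> real^'n \<Rightarrow> real^'n \<Rightarrow> 'n::finite \<Rightarrow> 'n \<Rightarrow> real" where
  "nonlinear_connection L x y j i =
     partial i (\<lambda>u. \<Sum>k\<in>UNIV. matrix_inv (fundamental_tensor L x u) $ j $ k *
        ((\<Sum>l\<in>UNIV. u $ l * partial l (\<lambda>z. partial k (\<lambda>w. (L z w)\<^sup>2) u) x)
           - partial k (\<lambda>z. (L z u)\<^sup>2) x)) y / 4"

definition local_fun :: "('p, 'n::finite) chart set \<Rightarrow> ('p, 'n) chart \<Rightarrow>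
    ('p \<Rightarrow> ('p, 'n) tvec \<Rightarrow> real) \<Rightarrow> real^'n \<Rightarrow> real^'n \<Rightarrow> real" where
  "local_fun M c F x y = F (chart_inv c x) (coord_vec M c x y)"

definition local_domain :: "('p, 'n::finite) chart set \<Rightarrow> ('p, 'n) chart \<Rightarrow>
    ('p \<times> ('p, 'n) tvec) set \<Rightarrow> ((real^'n) \<times> (real^'n)) set" where
  "local_domain M c A =
     {(x, y). x \<in> coord_image c UNIV \<and> (chart_inv c x, coord_vec M c x y) \<in> A}"

definition conic_subbundle :: "('p, 'n::finite) chart set \<Rightarrow>
    ('p \<times> ('p, 'n) tvec) set \<Rightarrow> bool" where
  "conic_subbundle M A \<longleftrightarrow>
     A \<subseteq> tangent_bundle M \<and>
     (\<forall>c\<in>M. open (local_domain M c A)) \<and>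
     (\<forall>(p, v)\<in>A. \<forall>t>0. (p, \<lambda>c. t *\<^sub>R v c) \<in> A) \<and>
     fst ` A = UNIV"

(* The values of F outside A are irrelevant. *)
definition finsler_metric :: "('p, 'n::finite) chart set \<Rightarrow>
    ('p \<times> ('p, 'n) tvec) set \<Rightarrow> ('p \<Rightarrow> ('p, 'n) tvec \<Rightarrow> real) \<Rightarrow> bool" where
  "finsler_metric M A F \<longleftrightarrow>
     conic_subbundle M A \<and>
     (\<forall>c\<in>M. smooth_on (local_domain M c A) (\<lambda>(x, y). local_fun M c F x y)) \<and>
     (\<forall>(p, v)\<in>A. F p v \<ge> 0) \<and>
     (\<forall>(p, v)\<in>A. \<forall>t>0. F p (\<lambda>c. t *\<^sub>R v c) = t * F p v) \<and>
     (\<forall>c\<in>M. \<forall>(x, y)\<in>local_domain M c A. invertible (fundamental_tensor (local_fun M c F) x y))"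

definition is_affine_connection :: "('p, 'n::finite) chart set \<Rightarrow>
    ('p \<times> ('p, 'n) tvec) set \<Rightarrow> ('p \<Rightarrow> ('p, 'n) tvec \<Rightarrow> real) \<Rightarrow>
    (('p, 'n) chart \<Rightarrow> real^'n \<Rightarrow> 'n \<Rightarrow> 'n \<Rightarrow> 'n \<Rightarrow> real) \<Rightarrow> bool" where
  "is_affine_connection M A F G \<longleftrightarrow>
     (\<forall>c\<in>M. \<forall>(x, y)\<in>local_domain M c A. \<forall>k i.
        nonlinear_connection (local_fun M c F) x y k i = (\<Sum>j\<in>UNIV. G c x k i j * y $ j))"

definition berwald_type :: "('p, 'n::finite) chart set \<Rightarrow>
    ('p \<times> ('p, 'n) tvec) set \<Rightarrow> ('p \<Rightarrow> ('p, 'n) tvec \<Rightarrow> real) \<Rightarrow> bool" where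
  "berwald_type M A F \<longleftrightarrow> (\<exists>G. is_affine_connection M A F G)"

(* For F of Berwald type and a chart c in M this is uniquely determined at all x in the
   coordinate domain of c, because the fibres of A are open and nonempty. *)
definition affine_connection :: "('p, 'n::finite) chart set \<Rightarrow>
    ('p \<times> ('p, 'n) tvec) set \<Rightarrow> ('p \<Rightarrow> ('p, 'n) tvec \<Rightarrow> real) \<Rightarrow>
    ('p, 'n) chart \<Rightarrow> real^'n \<Rightarrow> 'n \<Rightarrow> 'n \<Rightarrow> 'n \<Rightarrow> real" where
  "affine_connection M A F = (SOME G. is_affine_connection M A F G)"

definition ricci_symmetric :: "('p, 'n::finite) chart set \<Rightarrow>
    ('p \<times> ('p, 'n) tvec) set \<Rightarrow> ('p \<Rightarrow> ('p, 'n) tvec \<Rightarrow> real) \<Rightarrow> bool" where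
  "ricci_symmetric M A F \<longleftrightarrow> (\<forall>c\<in>M. \<forall>x\<in>coord_image c UNIV. \<forall>i j.
     ricci (affine_connection M A F c) x i j = ricci (affine_connection M A F c) x j i)"

definition local_metrization :: "('p, 'n::finite) chart set \<Rightarrow>
    ('p \<times> ('p, 'n) tvec) set \<Rightarrow> ('p \<Rightarrow> ('p, 'n) tvec \<Rightarrow> real) \<Rightarrow> 'p set \<Rightarrow>
    ('p \<Rightarrow> ('p, 'n) tvec \<Rightarrow> ('p, 'n) tvec \<Rightarrow> real) \<Rightarrow> bool" where
  "local_metrization M A F U g \<longleftrightarrow> metric_on M U g \<and>
     (\<forall>c\<in>M. \<forall>x\<in>coord_image c U. \<forall>k i j.
        christoffel (metric_comp M c g) x k i j = affine_connection M A F c x k i j)"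

definition locally_metrizable :: "('p::topological_space, 'n::finite) chart set \<Rightarrow>
    ('p \<times> ('p, 'n) tvec) set \<Rightarrow> ('p \<Rightarrow> ('p, 'n) tvec \<Rightarrow> real) \<Rightarrow> bool" where
  "locally_metrizable M A F \<longleftrightarrow>
     (\<forall>p. \<exists>U g. open U \<and> p \<in> U \<and> local_metrization M A F U g)"


section \<open>m-Kropina metrics\<close>

(* z to the real power s: for z > 0 both branches agree; for z < 0 only integer s make sense. *)
definition rpow :: "real \<Rightarrow> real \<Rightarrow> real" where
  "rpow z s = (if s \<in> \<int> then z powi \<lfloor>s\<rfloor> else z powr s)"

definition alpha :: "('p \<Rightarrow> ('p, 'n) tvec \<Rightarrow> ('p, 'n) tvec \<Rightarrow> real) \<Rightarrow> 'p \<Rightarrow> ('p, 'n) tvec \<Rightarrow> real" where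
  "alpha a p v = sqrt \<bar>a p v v\<bar>"

definition kropina_fun :: "real \<Rightarrow> ('p \<Rightarrow> ('p, 'n) tvec \<Rightarrow> ('p, 'n) tvec \<Rightarrow> real) \<Rightarrow>
    ('p \<Rightarrow> ('p, 'n) tvec \<Rightarrow> real) \<Rightarrow> 'p \<Rightarrow> ('p, 'n) tvec \<Rightarrow> real" where
  "kropina_fun m a b p v = rpow (alpha a p v) (1 + m) * rpow (b p v) (- m)"

(* The condition on alpha and beta says that the powers are defined. Zeros of alpha and beta
   do not have to be admitted: there F would fail to be smooth or the fundamental
   tensor would degenerate. *)
definition kropina_metric :: "('p, 'n::finite) chart set \<Rightarrow> ('p \<times> ('p, 'n) tvec) set \<Rightarrow> real \<Rightarrow>
    ('p \<Rightarrow> ('p, 'n) tvec \<Rightarrow> ('p, 'n) tvec \<Rightarrow> real) \<Rightarrow> ('p \<Rightarrow> ('p, 'n) tvec \<Rightarrow> real) \<Rightarrow>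
    ('p \<Rightarrow> ('p, 'n) tvec \<Rightarrow> real) \<Rightarrow> bool" where
  "kropina_metric M A m a b F \<longleftrightarrow>
     finsler_metric M A F \<and> metric_on M UNIV a \<and> one_form_on M UNIV b \<and>
     (\<forall>(p, v)\<in>A. alpha a p v > 0 \<and> (b p v > 0 \<or> (m \<in> \<int> \<and> b p v \<noteq> 0)) \<and>
        F p v = kropina_fun m a b p v)"

(* nabla_j b_i = m (f_k b^k) a_ij + b_i f_j - m f_i b_j, with the Levi-Civita connection of a. *)
definition berwald_condition :: "('p, 'n::finite) chart set \<Rightarrow> real \<Rightarrow>
    ('p \<Rightarrow> ('p, 'n) tvec \<Rightarrow> ('p, 'n) tvec \<Rightarrow> real) \<Rightarrow> ('p \<Rightarrow> ('p, 'n) tvec \<Rightarrow> real) \<Rightarrow>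
    ('p \<Rightarrow> ('p, 'n) tvec \<Rightarrow> real) \<Rightarrow> bool" where
  "berwald_condition M m a b f \<longleftrightarrow> (\<forall>c\<in>M. \<forall>x\<in>coord_image c UNIV. \<forall>i j.
     let ac = metric_comp M c a; bc = form_comp M c b; fc = form_comp M c f in
     cov_deriv (christoffel ac) bc x j i =
       m * (\<Sum>k\<in>UNIV. \<Sum>l\<in>UNIV. fc x $ k * matrix_inv (ac x) $ k $ l * bc x $ l) * ac x $ i $ j
       + bc x $ i * fc x $ j - m * fc x $ i * bc x $ j)"

definition parallel_on :: "('p, 'n::finite) chart set \<Rightarrow> 'p set \<Rightarrow>
    ('p \<Rightarrow> ('p, 'n) tvec \<Rightarrow> ('p, 'n) tvec \<Rightarrow> real) \<Rightarrow> ('p \<Rightarrow> ('p, 'n) tvec \<Rightarrow> real) \<Rightarrow> bool" where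
  "parallel_on M U a b \<longleftrightarrow> (\<forall>c\<in>M. \<forall>x\<in>coord_image c U. \<forall>i j.
     cov_deriv (christoffel (metric_comp M c a)) (form_comp M c b) x j i = 0)"

end

theory Submission
  imports Defs
begin

text \<open>
  Let \<open>\<Gamma>\<close> be the torsion-free connection \<open>\<Gamma>\<^sup>k\<^sub>i\<^sub>j(a) + m (a\<^sub>i\<^sub>j f\<^sup>k - \<delta>\<^sup>k\<^sub>j f\<^sub>i - \<delta>\<^sup>k\<^sub>i f\<^sub>j)\<close>. It satisfies
  \<open>\<nabla>\<^sub>l a\<^sub>i\<^sub>j = 2 m f\<^sub>l a\<^sub>i\<^sub>j\<close>, and the Berwald condition becomes \<open>\<nabla>\<^sub>l b\<^sub>i = (1 + m) f\<^sub>l b\<^sub>i\<close>, so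
  the two contributions to the derivative of \<open>F\<^sup>2 = \<bar>a(y,y)\<bar>\<^bsup>1+m\<^esup> \<bar>b(y)\<bar>\<^bsup>-2m\<^esup>\<close> cancel.
  A torsion-free connection annihilating \<open>F\<^sup>2\<close> is the affine connection of \<open>F\<close>.

  The antisymmetric part of the Ricci tensor of a torsion-free connection is the exterior
  derivative of its trace \<open>\<Gamma>\<^sup>i\<^sub>i\<^sub>l\<close>. This trace is closed for a Levi-Civita connection, and for \<open>\<Gamma>\<close>
  it differs from that of \<open>a\<close> by \<open>- m n f\<^sub>l\<close>, where \<open>n\<close> is the dimension. Finally, if \<open>f = d\<psi>\<close>,
  the factors \<open>e\<^bsup>-2m\<psi>\<^esup>\<close> and \<open>e\<^bsup>-(1+m)\<psi>\<^esup>\<close> absorb the right-hand sides above.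
\<close>

section \<open>Calculus on open sets\<close>

text \<open>The cancellation in the derivative of \<open>F^2\<close> is (1 + m) * 2 m - 2 m * (1 +
  m) = 0: the covariant derivatives of a(y,y) and b(y) are multiples of the same covector
  \<open>f\<close>, with weights 2 m and 1 + m, and each exponent in \<open>F^2\<close> is, up to
  sign, the weight of the other factor. The negated weights are the exponents of the conformal
  factors. The nonlinear connection of \<open>F\<close> involves the inverse fundamental tensor,
  which is never computed. Horizontal constancy of \<open>F^2\<close> is differentiated along the
  fibre instead, and the fundamental tensor that then appears cancels its inverse.
  \<open>affine_connection\<close> is a choice. It is harmless because the fibres of
  \<open>A\<close> are open and nonempty, so a linear function of \<open>y\<close> prescribed on a
  fibre determines its coefficients. Since \<open>a\<close> may be indefinite and beta may be
  negative for integer \<open>m\<close>, everything is differentiated at the level of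
  \<open>F^2\<close>, where powers of absolute values cover all signs. Closedness of
  \<open>f\<close> yields a potential only on a ball in one chart, so a potential built there has to
  be carried to all other charts.\<close>

lemma Ck_on_cong:
  assumes "open S" "\<And>x. x \<in> S \<Longrightarrow> f x = g x" "Ck_on k S f"
  shows "Ck_on k S g"
  using assms(2,3)
proof (induction k arbitrary: f g)
  case 0
  then show ?case by (simp cong: continuous_on_cong)
next
  case (Suc k)
  have D: "(g has_derivative frechet_derivative f (at x)) (at x)" if "x \<in> S" for x
    using Suc.prems that assms(1) has_derivative_transform_within_open
    by (metis Ck_on.simps(2) frechet_derivative_works)
  have "frechet_derivative g (at x) = frechet_derivative f (at x)" if "x \<in> S" for x
    using frechet_derivative_at[OF D[OF that]] by simp
  then have "Ck_on k S (\<lambda>x. frechet_derivative g (at x) v)" for v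
    using Suc.IH[of "\<lambda>x. frechet_derivative f (at x) v" "\<lambda>x. frechet_derivative g (at x) v"] Suc.prems(2)
    by simp
  then show ?case using D by (auto simp: differentiable_def)
qed

lemma Ck_on_Suc_imp: "Ck_on (Suc k) S f \<Longrightarrow> Ck_on k S f"
proof (induction k arbitrary: f)
  case 0
  then show ?case
    by (auto intro!: continuous_at_imp_continuous_on differentiable_imp_continuous_within)
next
  case (Suc k)
  then show ?case by (metis Ck_on.simps(2))
qed

lemma Ck_on_subset: "Ck_on k S f \<Longrightarrow> T \<subseteq> S \<Longrightarrow> Ck_on k T f"
proof (induction k arbitrary: f)
  case 0
  then show ?case by (auto intro: continuous_on_subset)
next
  case (Suc k)
  then show ?case by (auto simp: subset_iff)
qed

lemma Ck_on_add:
  assumes "open S" "Ck_on k S f" "Ck_on k S g"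
  shows "Ck_on k S (\<lambda>x. f x + g x)"
  using assms(2,3)
proof (induction k arbitrary: f g)
  case 0
  then show ?case by (auto intro: continuous_intros)
next
  case (Suc k)
  have D: "((\<lambda>x. f x + g x) has_derivative
      (\<lambda>v. frechet_derivative f (at x) v + frechet_derivative g (at x) v)) (at x)" if "x \<in> S" for x
    using Suc.prems that
    by (intro has_derivative_add) (auto simp: frechet_derivative_works[symmetric])
  have "Ck_on k S (\<lambda>x. frechet_derivative (\<lambda>x. f x + g x) (at x) v)" for v
  proof (rule Ck_on_cong[OF assms(1)])
    show "Ck_on k S (\<lambda>x. frechet_derivative f (at x) v + frechet_derivative g (at x) v)"
      using Suc by simp
  qed (simp add: frechet_derivative_at[OF D, symmetric])
  then show ?case using D by (auto simp: differentiable_def)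
qed

lemma Ck_on_mult:
  fixes f g :: "'a::euclidean_space \<Rightarrow> real"
  assumes "open S" "Ck_on k S f" "Ck_on k S g"
  shows "Ck_on k S (\<lambda>x. f x * g x)"
  using assms(2,3)
proof (induction k arbitrary: f g)
  case 0
  then show ?case by (auto intro: continuous_intros)
next
  case (Suc k)
  have D: "((\<lambda>x. f x * g x) has_derivative
      (\<lambda>v. f x * frechet_derivative g (at x) v + frechet_derivative f (at x) v * g x)) (at x)"
    if "x \<in> S" for x
    using Suc.prems that
    by (intro has_derivative_mult) (auto simp: frechet_derivative_works[symmetric])
  have "Ck_on k S (\<lambda>x. frechet_derivative (\<lambda>x. f x * g x) (at x) v)" for v
  proof (rule Ck_on_cong[OF assms(1)])
    show "Ck_on k S (\<lambda>x. f x * frechet_derivative g (at x) v + frechet_derivative f (at x) v * g x)"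
      using Suc.prems by (intro Ck_on_add Suc.IH assms(1)) (auto dest: Ck_on_Suc_imp simp del: Ck_on.simps, auto)
  qed (simp add: frechet_derivative_at[OF D, symmetric])
  then show ?case using D by (auto simp: differentiable_def)
qed

lemma Ck_on_exp:
  fixes f :: "'a::euclidean_space \<Rightarrow> real"
  assumes "open S" "Ck_on k S f"
  shows "Ck_on k S (\<lambda>x. exp (f x))"
  using assms(2)
proof (induction k)
  case 0
  then show ?case by (auto intro: continuous_intros)
next
  case (Suc k)
  have D: "((\<lambda>x. exp (f x)) has_derivative
      (\<lambda>v. exp (f x) * frechet_derivative f (at x) v)) (at x)"
    if "x \<in> S" for x
    using Suc.prems that
    by (auto simp: frechet_derivative_works[symmetric] intro!: derivative_eq_intros)
  have "Ck_on k S (\<lambda>x. frechet_derivative (\<lambda>x. exp (f x)) (at x) v)" for v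
  proof (rule Ck_on_cong[OF assms(1)])
    show "Ck_on k S (\<lambda>x. exp (f x) * frechet_derivative f (at x) v)"
      using Suc Ck_on_Suc_imp[OF Suc.prems] by (intro Ck_on_mult assms(1)) auto
  qed (simp add: frechet_derivative_at[OF D, symmetric])
  then show ?case using D by (auto simp: differentiable_def)
qed

lemma Ck_on_const: "Ck_on k S (\<lambda>x. c)"
  by (induction k arbitrary: c) auto

lemma Ck_on_has_derivative:
  "Ck_on (Suc k) S f \<Longrightarrow> x \<in> S \<Longrightarrow> (f has_derivative frechet_derivative f (at x)) (at x)"
  by (simp add: frechet_derivative_works[symmetric])

lemma smooth_onD: "smooth_on S f \<Longrightarrow> Ck_on k S f"
  by (simp add: smooth_on_def)

lemma smooth_on_differentiable: "smooth_on S f \<Longrightarrow> x \<in> S \<Longrightarrow> f differentiable (at x)"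
  using smooth_onD[of S f "Suc 0"] by simp

lemma smooth_on_subset: "smooth_on S f \<Longrightarrow> T \<subseteq> S \<Longrightarrow> smooth_on T f"
  by (auto simp: smooth_on_def intro: Ck_on_subset)

lemma smooth_on_mult:
  fixes f g :: "'a::euclidean_space \<Rightarrow> real"
  shows "open S \<Longrightarrow> smooth_on S f \<Longrightarrow> smooth_on S g \<Longrightarrow> smooth_on S (\<lambda>x. f x * g x)"
  by (auto simp: smooth_on_def intro: Ck_on_mult)

lemma smooth_on_exp:
  fixes f :: "'a::euclidean_space \<Rightarrow> real"
  shows "open S \<Longrightarrow> smooth_on S f \<Longrightarrow> smooth_on S (\<lambda>x. exp (f x))"
  by (auto simp: smooth_on_def intro: Ck_on_exp)

lemma smooth_on_const: "smooth_on S (\<lambda>x. c)"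
  by (auto simp: smooth_on_def Ck_on_const)

lemma smooth_on_add:
  "open S \<Longrightarrow> smooth_on S f \<Longrightarrow> smooth_on S g \<Longrightarrow> smooth_on S (\<lambda>x. f x + g x)"
  by (auto simp: smooth_on_def intro: Ck_on_add)

lemma smooth_on_sum:
  assumes "open S" "\<And>i. i \<in> I \<Longrightarrow> smooth_on S (f i)"
  shows "smooth_on S (\<lambda>x. \<Sum>i\<in>I. f i x)"
  using assms(2) by (induction I rule: infinite_finite_induct)
    (auto simp: smooth_on_const intro: smooth_on_add[OF assms(1)])

text \<open>Symmetry of second derivatives: by the mean value theorem the second difference is
  \<open>s\<^sup>2\<close> times either mixed derivative at a nearby point.\<close>

lemma second_difference:
  fixes h :: "'a::euclidean_space \<Rightarrow> real"
  assumes h: "Ck_on (Suc (Suc 0)) S h" and s: "s > 0"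
    and S: "\<And>\<sigma> \<tau>. 0 \<le> \<sigma> \<Longrightarrow> \<sigma> \<le> s \<Longrightarrow> 0 \<le> \<tau> \<Longrightarrow> \<tau> \<le> s \<Longrightarrow> x + \<sigma> *\<^sub>R v + \<tau> *\<^sub>R w \<in> S"
  shows "\<exists>\<sigma> \<tau>. 0 \<le> \<sigma> \<and> \<sigma> \<le> s \<and> 0 \<le> \<tau> \<and> \<tau> \<le> s \<and>
    h (x + s *\<^sub>R v + s *\<^sub>R w) - h (x + s *\<^sub>R v) - h (x + s *\<^sub>R w) + h x =
    s * s * frechet_derivative (\<lambda>z. frechet_derivative h (at z) v) (at (x + \<sigma> *\<^sub>R v + \<tau> *\<^sub>R w)) w"
proof -
  let ?D = "\<lambda>z. frechet_derivative h (at z)"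
  let ?D2 = "\<lambda>z. frechet_derivative (\<lambda>z. ?D z v) (at z)"
  have lin: "linear (?D z)" "linear (?D2 z)" if "z \<in> S" for z
    using h that by (auto intro: linear_frechet_derivative)
  have d1: "((\<lambda>\<sigma>. h (x + \<sigma> *\<^sub>R v + \<tau> *\<^sub>R w)) has_real_derivative ?D (x + \<sigma> *\<^sub>R v + \<tau> *\<^sub>R w) v) (at \<sigma>)"
    if "x + \<sigma> *\<^sub>R v + \<tau> *\<^sub>R w \<in> S" for \<sigma> \<tau>
  proof -
    have "(h has_derivative ?D (x + \<sigma> *\<^sub>R v + \<tau> *\<^sub>R w)) (at (x + \<sigma> *\<^sub>R v + \<tau> *\<^sub>R w))"
      using Ck_on_has_derivative[OF h that] .
    then have "((\<lambda>\<sigma>. h (x + \<sigma> *\<^sub>R v + \<tau> *\<^sub>R w)) has_derivative (\<lambda>d. ?D (x + \<sigma> *\<^sub>R v + \<tau> *\<^sub>R w) (d *\<^sub>R v))) (at \<sigma>)"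
      by (rule has_derivative_compose[rotated]) (auto intro!: derivative_eq_intros)
    then show ?thesis
      using lin(1)[OF that] by (simp add: has_field_derivative_def linear_cmul mult_commute_abs)
  qed
  have d2: "((\<lambda>\<tau>. ?D (x + \<sigma> *\<^sub>R v + \<tau> *\<^sub>R w) v) has_real_derivative ?D2 (x + \<sigma> *\<^sub>R v + \<tau> *\<^sub>R w) w) (at \<tau>)"
    if "x + \<sigma> *\<^sub>R v + \<tau> *\<^sub>R w \<in> S" for \<sigma> \<tau>
  proof -
    have "((\<lambda>z. ?D z v) has_derivative ?D2 (x + \<sigma> *\<^sub>R v + \<tau> *\<^sub>R w)) (at (x + \<sigma> *\<^sub>R v + \<tau> *\<^sub>R w))"
      using h that by (intro Ck_on_has_derivative[of 0 S]) auto
    then have "((\<lambda>\<tau>. ?D (x + \<sigma> *\<^sub>R v + \<tau> *\<^sub>R w) v) has_derivative (\<lambda>d. ?D2 (x + \<sigma> *\<^sub>R v + \<tau> *\<^sub>R w) (d *\<^sub>R w))) (at \<tau>)"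
      by (rule has_derivative_compose[rotated]) (auto intro!: derivative_eq_intros)
    then show ?thesis
      using lin(2)[OF that] by (simp add: has_field_derivative_def linear_cmul mult_commute_abs)
  qed
  \<comment> \<open>The second difference is \<open>\<phi> s - \<phi> 0\<close>. The mean value
    theorem in direction \<open>v\<close> leaves a first difference in direction \<open>w\<close>,
    to which it is applied again.\<close>
  define \<phi> where "\<phi> \<sigma> = h (x + \<sigma> *\<^sub>R v + s *\<^sub>R w) - h (x + \<sigma> *\<^sub>R v + 0 *\<^sub>R w)" for \<sigma>
  have "\<exists>\<sigma>>0. \<sigma> < s \<and> \<phi> s - \<phi> 0 =
      (s - 0) * (?D (x + \<sigma> *\<^sub>R v + s *\<^sub>R w) v - ?D (x + \<sigma> *\<^sub>R v + 0 *\<^sub>R w) v)"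
    unfolding \<phi>_def using s
    by (intro MVT2 DERIV_diff d1 S) auto
  then obtain \<sigma> where \<sigma>: "0 < \<sigma>" "\<sigma> < s" "\<phi> s - \<phi> 0 =
      s * (?D (x + \<sigma> *\<^sub>R v + s *\<^sub>R w) v - ?D (x + \<sigma> *\<^sub>R v + 0 *\<^sub>R w) v)" by auto
  have "\<exists>\<tau>>0. \<tau> < s \<and> ?D (x + \<sigma> *\<^sub>R v + s *\<^sub>R w) v - ?D (x + \<sigma> *\<^sub>R v + 0 *\<^sub>R w) v =
     (s - 0) * ?D2 (x + \<sigma> *\<^sub>R v + \<tau> *\<^sub>R w) w"
    using s \<sigma> by (intro MVT2 d2 S) auto
  then obtain \<tau> where \<tau>: "0 < \<tau>" "\<tau> < s" "?D (x + \<sigma> *\<^sub>R v + s *\<^sub>R w) v - ?D (x + \<sigma> *\<^sub>R v + 0 *\<^sub>R w) v =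
     s * ?D2 (x + \<sigma> *\<^sub>R v + \<tau> *\<^sub>R w) w" by auto
  show ?thesis
    using \<sigma> \<tau> by (intro exI[of _ \<sigma>] exI[of _ \<tau>]) (auto simp: \<phi>_def algebra_simps)
qed

lemma mixed_derivative_commute:
  fixes h :: "'a::euclidean_space \<Rightarrow> real"
  assumes "open S" "x \<in> S" and h: "Ck_on (Suc (Suc 0)) S h"
  shows "frechet_derivative (\<lambda>z. frechet_derivative h (at z) v) (at x) w =
    frechet_derivative (\<lambda>z. frechet_derivative h (at z) w) (at x) v"
proof (rule ccontr)
  let ?D2 = "\<lambda>v w z. frechet_derivative (\<lambda>z. frechet_derivative h (at z) v) (at z) w"
  assume neq: "\<not> ?thesis"
  define e where "e = \<bar>?D2 v w x - ?D2 w v x\<bar>"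
  have e: "e > 0" using neq by (simp add: e_def)
  have "continuous_on S (?D2 v w)" for v w using h by auto
  then have "isCont (?D2 v w) x" for v w
    using assms(1,2) by (simp add: continuous_on_eq_continuous_at)
  then have ev: "\<exists>d>0. \<forall>z. dist z x < d \<longrightarrow> dist (?D2 v w z) (?D2 v w x) < e / 2" for v w
    using e half_gt_zero[OF e] unfolding continuous_at_eps_delta by blast
  obtain d1 where d1: "d1 > 0" "\<And>z. dist z x < d1 \<Longrightarrow> dist (?D2 v w z) (?D2 v w x) < e / 2"
    using ev[of v w] by blast
  obtain d2 where d2: "d2 > 0" "\<And>z. dist z x < d2 \<Longrightarrow> dist (?D2 w v z) (?D2 w v x) < e / 2"
    using ev[of w v] by blast
  obtain d3 where d3: "d3 > 0" "\<And>z. dist z x < d3 \<Longrightarrow> z \<in> S"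
    using assms(1,2) unfolding open_dist by blast
  define d where "d = min d1 (min d2 d3)"
  have d: "d > 0" using d1 d2 d3 by (simp add: d_def)
  have close: "z \<in> S \<and> dist (?D2 v w z) (?D2 v w x) < e / 2 \<and> dist (?D2 w v z) (?D2 w v x) < e / 2"
    if "dist z x < d" for z
    using d1(2) d2(2) d3(2) that by (simp add: d_def)
  define N where "N = norm v + norm w + 1"
  \<comment> \<open>Chosen so that the whole parallelogram spanned by \<open>s v\<close> and
    \<open>s w\<close> stays within \<open>d / 2\<close> of \<open>x\<close>; the summand 1 in
    \<open>N\<close> keeps the quotient defined when \<open>v = w = 0\<close>.\<close>
  define s where "s = d / (2 * N)"
  have pos: "N > 0" unfolding N_def by (smt (verit) norm_ge_zero)
  have s: "s > 0" using d pos by (simp add: s_def)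
  have near: "dist (x + \<sigma> *\<^sub>R v + \<tau> *\<^sub>R w) x < d" if "0 \<le> \<sigma>" "\<sigma> \<le> s" "0 \<le> \<tau>" "\<tau> \<le> s" for \<sigma> \<tau>
  proof -
    have "dist (x + \<sigma> *\<^sub>R v + \<tau> *\<^sub>R w) x \<le> \<sigma> * norm v + \<tau> * norm w"
      using that norm_triangle_ineq[of "\<sigma> *\<^sub>R v" "\<tau> *\<^sub>R w"] by (simp add: dist_norm)
    also have "\<dots> \<le> s * norm v + s * norm w"
      using that by (intro add_mono mult_right_mono) auto
    also have "\<dots> < s * N" using s by (simp add: N_def algebra_simps)
    also have "\<dots> = d / 2" using pos by (simp add: s_def)
    finally show ?thesis using d by simp
  qed
  obtain \<sigma> \<tau> where 1: "0 \<le> \<sigma>" "\<sigma> \<le> s" "0 \<le> \<tau>" "\<tau> \<le> s"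
    "h (x + s *\<^sub>R v + s *\<^sub>R w) - h (x + s *\<^sub>R v) - h (x + s *\<^sub>R w) + h x = s * s * ?D2 v w (x + \<sigma> *\<^sub>R v + \<tau> *\<^sub>R w)"
    using second_difference[OF h s, of x v w] close near by blast
  have near': "dist (x + \<sigma> *\<^sub>R w + \<tau> *\<^sub>R v) x < d" if "0 \<le> \<sigma>" "\<sigma> \<le> s" "0 \<le> \<tau>" "\<tau> \<le> s" for \<sigma> \<tau>
    using near[of \<tau> \<sigma>] that by (simp add: add.commute add.left_commute)
  obtain \<sigma>' \<tau>' where 2: "0 \<le> \<sigma>'" "\<sigma>' \<le> s" "0 \<le> \<tau>'" "\<tau>' \<le> s"
    "h (x + s *\<^sub>R w + s *\<^sub>R v) - h (x + s *\<^sub>R w) - h (x + s *\<^sub>R v) + h x = s * s * ?D2 w v (x + \<sigma>' *\<^sub>R w + \<tau>' *\<^sub>R v)"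
    using second_difference[OF h s, of x w v] close near' by blast
  \<comment> \<open>The second difference does not change when \<open>v\<close> and \<open>w\<close>
    are exchanged, so the two mixed derivatives agree at two nearby points. Each is within
    \<open>e / 2\<close> of its value at \<open>x\<close>, although these values are
    \<open>e\<close> apart.\<close>
  have "x + s *\<^sub>R w + s *\<^sub>R v = x + s *\<^sub>R v + s *\<^sub>R w" by simp
  then have "s * s * ?D2 v w (x + \<sigma> *\<^sub>R v + \<tau> *\<^sub>R w) = s * s * ?D2 w v (x + \<sigma>' *\<^sub>R w + \<tau>' *\<^sub>R v)"
    using 1(5) 2(5) by (simp only:)
  then have "?D2 v w (x + \<sigma> *\<^sub>R v + \<tau> *\<^sub>R w) = ?D2 w v (x + \<sigma>' *\<^sub>R w + \<tau>' *\<^sub>R v)"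
    using s by simp
  then show False
    using close[OF near[OF 1(1-4)], THEN conjunct2, THEN conjunct1]
      close[OF near'[OF 2(1-4)], THEN conjunct2, THEN conjunct2]
    unfolding dist_real_def e_def by (smt (verit) field_sum_of_halves)
qed

section \<open>Partial derivatives\<close>

lemma partial_eqI: "(h has_derivative h') (at x) \<Longrightarrow> partial i h x = h' (axis i 1)"
  using frechet_derivative_at[of h h' x] by (simp add: partial_def)

text \<open>Covers points without a derivative as well: \<open>frechet_derivative\<close> chooses
  from the set of derivatives, and the two sets coincide.\<close>

lemma partial_cong:
  assumes "open S" "x \<in> S" "\<And>z. z \<in> S \<Longrightarrow> g z = h z"
  shows "partial i g x = partial i h x"
proof -
  have "(g has_derivative D) (at x) \<longleftrightarrow> (h has_derivative D) (at x)" for D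
    using has_derivative_transform_within_open[OF _ assms(1,2), of g D UNIV h]
      has_derivative_transform_within_open[OF _ assms(1,2), of h D UNIV g] assms(3) by auto
  then show ?thesis by (simp add: partial_def frechet_derivative_def)
qed

lemma differentiable_cong_open:
  assumes "open S" "x \<in> S" "\<And>z. z \<in> S \<Longrightarrow> g z = h z" "g differentiable (at x)"
  shows "h differentiable (at x)"
proof -
  obtain D where "(g has_derivative D) (at x)"
    using assms(4) by (auto simp: differentiable_def)
  then show ?thesis
    by (rule differentiableI[OF has_derivative_transform_within_open[OF _ assms(1-3)]])
qed

lemma partial_mult:
  assumes "g differentiable (at x)" "h differentiable (at x)"
  shows "partial i (\<lambda>z. g z * h z) x = partial i g x * h x + g x * partial i h x"
  by (subst partial_eqI[OF has_derivative_mult[OF assms[unfolded frechet_derivative_works]]])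
    (simp add: partial_def)

lemma partial_add:
  assumes "g differentiable (at x)" "h differentiable (at x)"
  shows "partial i (\<lambda>z. g z + h z) x = partial i g x + partial i h x"
  by (subst partial_eqI[OF has_derivative_add[OF assms[unfolded frechet_derivative_works]]])
    (simp add: partial_def)

lemma partial_sum:
  assumes "\<And>k. k \<in> I \<Longrightarrow> g k differentiable (at x)"
  shows "partial i (\<lambda>z. \<Sum>k\<in>I. g k z) x = (\<Sum>k\<in>I. partial i (g k) x)"
  by (subst partial_eqI[OF has_derivative_sum[OF assms[unfolded frechet_derivative_works]]])
    (simp_all add: partial_def)

lemma partial_const: "partial i (\<lambda>z. c) x = 0"
  by (simp add: partial_def)

lemma partial_cmult:
  assumes "g differentiable (at x)"
  shows "partial i (\<lambda>z. c * g z) x = c * partial i g x"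
  using partial_mult[OF differentiable_const assms] by (simp add: partial_const)

lemma linear_axis_expansion:
  fixes f :: "real^'n::finite \<Rightarrow> real"
  assumes "linear f"
  shows "f v = (\<Sum>i\<in>UNIV. v $ i * f (axis i 1))"
proof -
  have "f v = f (\<Sum>i\<in>UNIV. v $ i *\<^sub>R axis i 1)"
    by (metis (no_types, lifting) basis_expansion scalar_mult_eq_scaleR sum.cong)
  then show ?thesis
    using assms by (simp add: linear_sum linear_cmul)
qed

lemma frechet_derivative_partials:
  assumes "h differentiable (at x)"
  shows "frechet_derivative h (at x) v = (\<Sum>i\<in>UNIV. v $ i * partial i h x)"
  unfolding partial_def by (rule linear_axis_expansion[OF linear_frechet_derivative[OF assms]])

lemma smooth_on_partial: "smooth_on S h \<Longrightarrow> smooth_on S (partial i h)"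
  unfolding smooth_on_def partial_def[abs_def] using Ck_on.simps(2) by blast

lemma partial_commute:
  assumes "open S" "x \<in> S" "smooth_on S h"
  shows "partial i (partial j h) x = partial j (partial i h) x"
  using mixed_derivative_commute[OF assms(1,2) smooth_onD[OF assms(3)]]
  by (simp add: partial_def[abs_def])

text \<open>\<open>Ck_on\<close> inspects directional derivatives, which are constant combinations
  of the partials. For a potential of \<open>f\<close> the partials are components of
  \<open>f\<close>, so this gives its smoothness in every chart without a theorem on composing
  smooth maps.\<close>

lemma smooth_on_from_partials:
  assumes D: "\<And>x. x \<in> S \<Longrightarrow> h differentiable (at x)"
    and w: "\<And>i x. x \<in> S \<Longrightarrow> partial i h x = w i x" "\<And>i. smooth_on S (w i)" and "open S"
  shows "smooth_on S h"
proof -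
  have "Ck_on k S h" for k
  proof (cases k)
    case 0
    then show ?thesis using D
      by (auto intro!: continuous_at_imp_continuous_on differentiable_imp_continuous_within)
  next
    case (Suc k)
    have "Ck_on k S (\<lambda>x. frechet_derivative h (at x) v)" for v
    proof (rule Ck_on_cong[OF \<open>open S\<close>])
      show "Ck_on k S (\<lambda>x. \<Sum>i\<in>UNIV. v $ i * w i x)"
        by (intro smooth_onD smooth_on_sum smooth_on_mult smooth_on_const w \<open>open S\<close>)
    qed (simp add: frechet_derivative_partials[OF D] w(1))
    then show ?thesis using D Suc by simp
  qed
  then show ?thesis by (simp add: smooth_on_def)
qed

section \<open>Tensor calculus in a coordinate domain\<close>

lemma matrix_inv_mult:
  assumes "invertible A"
  shows "A ** matrix_inv A = mat 1" "matrix_inv A ** A = mat 1"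
  using assms someI_ex[of "\<lambda>B. A ** B = mat 1 \<and> B ** A = mat 1"]
  by (auto simp: invertible_def matrix_inv_def)

lemma matrix_inv_entries:
  fixes A :: "real^'n::finite^'n"
  assumes "invertible A"
  shows "(\<Sum>k\<in>UNIV. A $ i $ k * matrix_inv A $ k $ j) = (if i = j then 1 else 0)"
    and "(\<Sum>k\<in>UNIV. matrix_inv A $ i $ k * A $ k $ j) = (if i = j then 1 else 0)"
  using matrix_inv_mult[OF assms] by (simp_all add: vec_eq_iff matrix_matrix_mult_def mat_def)

text \<open>The index form of A (B v) = v, read in row \<open>h\<close>; a matrix and its inverse
  fit in either order.\<close>

lemma sum_contract:
  fixes A B :: "'n::finite \<Rightarrow> 'n \<Rightarrow> real"
  assumes "\<And>j. (\<Sum>k\<in>UNIV. A h k * B k j) = (if h = j then 1 else 0)"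
  shows "(\<Sum>k\<in>UNIV. A h k * (\<Sum>l\<in>UNIV. B k l * v l)) = v h"
proof -
  have "(\<Sum>k\<in>UNIV. A h k * (\<Sum>l\<in>UNIV. B k l * v l)) = (\<Sum>k\<in>UNIV. \<Sum>l\<in>UNIV. A h k * B k l * v l)"
    by (simp add: sum_distrib_left mult.assoc)
  also have "\<dots> = (\<Sum>l\<in>UNIV. (\<Sum>k\<in>UNIV. A h k * B k l) * v l)"
    by (subst sum.swap) (simp add: sum_distrib_right)
  also have "\<dots> = (\<Sum>l\<in>UNIV. if h = l then v l else 0)"
    by (intro sum.cong refl) (simp add: assms)
  also have "\<dots> = v h" by simp
  finally show ?thesis .
qed

lemmas sum_contract_inv = sum_contract[OF matrix_inv_entries(1)] sum_contract[OF matrix_inv_entries(2)]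

text \<open>For symmetric \<open>A\<close>, row \<open>j\<close> of the inverse solves A u = e_j,
  and so does column \<open>j\<close>.\<close>

lemma matrix_inv_symmetric:
  fixes A :: "real^'n::finite^'n"
  assumes "invertible A" "\<And>i j. A $ i $ j = A $ j $ i"
  shows "matrix_inv A $ i $ j = matrix_inv A $ j $ i"
proof -
  have "(\<Sum>k\<in>UNIV. matrix_inv A $ i $ k * (\<Sum>l\<in>UNIV. A $ k $ l * matrix_inv A $ j $ l)) = matrix_inv A $ j $ i"
    by (rule sum_contract_inv(2)[OF assms(1)])
  moreover have "(\<Sum>l\<in>UNIV. A $ k $ l * matrix_inv A $ j $ l) = (if j = k then 1 else 0)" for k
    using matrix_inv_entries(2)[OF assms(1), of j k] by (simp add: assms(2)[of k] mult.commute)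
  ultimately show ?thesis by (simp add: if_distrib cong: if_cong)
qed

lemma differentiable_det:
  fixes A :: "'a::real_normed_vector \<Rightarrow> real^'n::finite^'n"
  assumes "\<And>i j. (\<lambda>z. A z $ i $ j) differentiable (at x)"
  shows "(\<lambda>z. det (A z)) differentiable (at x)"
proof -
  have "(\<lambda>z. \<Prod>i\<in>UNIV. A z $ i $ p i) differentiable (at x)" for p
    by (rule differentiableI[OF has_derivative_prod[OF assms[unfolded frechet_derivative_works]]])
  then show ?thesis unfolding det_def by (intro differentiable_sum differentiable_mult differentiable_const) auto
qed

text \<open>Cramer's rule: the entry is det C / det A, where \<open>C\<close> is \<open>A\<close>
  with column \<open>i\<close> replaced by the \<open>j\<close>-th unit vector, and determinants are
  polynomials in the entries.\<close>

lemma differentiable_matrix_inv: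
  fixes A :: "'a::real_normed_vector \<Rightarrow> real^'n::finite^'n"
  assumes "open X" "x \<in> X" "\<And>z. z \<in> X \<Longrightarrow> invertible (A z)"
    and "\<And>i j. (\<lambda>z. A z $ i $ j) differentiable (at x)"
  shows "(\<lambda>z. matrix_inv (A z) $ i $ j) differentiable (at x)"
proof -
  define C where "C z = (\<chi> p q. if q = i then axis j 1 $ p else A z $ p $ q)" for z
  have eq: "matrix_inv (A z) $ i $ j = det (C z) / det (A z)" if "z \<in> X" for z
  proof -
    have "A z *v (matrix_inv (A z) *v axis j 1) = axis j 1"
      using matrix_inv_mult[OF assms(3)[OF that]] by (simp add: matrix_vector_mul_assoc)
    then have "matrix_inv (A z) *v axis j 1 =
        (\<chi> k. det (\<chi> p q. if q = k then axis j 1 $ p else A z $ p $ q) / det (A z))"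
      using cramer invertible_det_nz assms(3)[OF that] by blast
    from arg_cong[OF this, of "\<lambda>v. v $ i"] show ?thesis
      by (simp add: C_def matrix_vector_mult_basis column_def)
  qed
  have "(\<lambda>z. C z $ p $ q) differentiable (at x)" for p q
    using assms(4) by (cases "q = i") (simp_all add: C_def)
  then have "(\<lambda>z. det (C z) / det (A z)) differentiable (at x)"
    using assms(2-4) invertible_det_nz[of "A x"] by (intro differentiable_divide differentiable_det) auto
  then show ?thesis
    by (rule differentiable_cong_open[OF assms(1,2), rotated]) (simp add: eq)
qed

text \<open>Summing over pairs reduces the exchange of (i, j) with (p, q) to a single swap of two
  sums.\<close>

lemma sum_quad_swap:
  fixes T :: "'n::finite \<Rightarrow> 'n \<Rightarrow> 'n \<Rightarrow> 'n \<Rightarrow> real"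
  shows "(\<Sum>i\<in>UNIV. \<Sum>j\<in>UNIV. \<Sum>p\<in>UNIV. \<Sum>q\<in>UNIV. T i j p q) =
    (\<Sum>i\<in>UNIV. \<Sum>j\<in>UNIV. \<Sum>p\<in>UNIV. \<Sum>q\<in>UNIV. T p q i j)"
proof -
  have pair: "(\<Sum>i\<in>UNIV. \<Sum>j\<in>UNIV. g i j) = (\<Sum>u\<in>UNIV. g (fst u) (snd u))"
    for g :: "'n \<Rightarrow> 'n \<Rightarrow> real"
    by (simp add: sum.cartesian_product case_prod_unfold)
  show ?thesis unfolding pair by (rule sum.swap)
qed

section \<open>The Levi-Civita connection of a metric in coordinates: compatibility, uniqueness,
  trace\<close>

locale metric_field =
  fixes X :: "(real^'n::finite) set" and a :: "real^'n \<Rightarrow> real^'n^'n"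
  assumes open_X: "open X"
    and sym: "x \<in> X \<Longrightarrow> a x $ i $ j = a x $ j $ i"
    and inv: "x \<in> X \<Longrightarrow> invertible (a x)"
    and smooth: "smooth_on X (\<lambda>x. a x $ i $ j)"
begin

lemma diff: "x \<in> X \<Longrightarrow> (\<lambda>z. a z $ i $ j) differentiable (at x)"
  using smooth by (rule smooth_on_differentiable)

lemma partial_sym: "x \<in> X \<Longrightarrow> partial l (\<lambda>z. a z $ i $ j) x = partial l (\<lambda>z. a z $ j $ i) x"
  by (rule partial_cong[OF open_X]) (auto simp: sym)

lemma christoffel_sym: "x \<in> X \<Longrightarrow> christoffel a x k i j = christoffel a x k j i"
  using partial_sym[of x _ i j] by (simp add: christoffel_def add.commute)

lemma christoffel_lower:
  assumes "x \<in> X"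
  shows "(\<Sum>k\<in>UNIV. a x $ h $ k * christoffel a x k i j) =
    (partial i (\<lambda>z. a z $ j $ h) x + partial j (\<lambda>z. a z $ i $ h) x - partial h (\<lambda>z. a z $ i $ j) x) / 2"
  using sum_contract_inv(1)[OF inv[OF assms], of h "\<lambda>h. partial i (\<lambda>z. a z $ j $ h) x + partial j (\<lambda>z. a z $ i $ h) x - partial h (\<lambda>z. a z $ i $ j) x"]
  by (simp add: christoffel_def sum_divide_distrib[symmetric])

text \<open>Metric compatibility. In the sum of the two lowered Christoffel symbols all derivatives
  cancel in pairs except two halves of the one on the left.\<close>

lemma partial_metric:
  assumes "x \<in> X"
  shows "partial l (\<lambda>z. a z $ i $ j) x =
    (\<Sum>k\<in>UNIV. a x $ j $ k * christoffel a x k l i) + (\<Sum>k\<in>UNIV. a x $ i $ k * christoffel a x k l j)"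
  unfolding christoffel_lower[OF assms]
  using partial_sym[OF assms, of l j i] partial_sym[OF assms, of j l i] partial_sym[OF assms, of i l j]
  by (simp add: field_simps)

text \<open>The Koszul computation at a single point: by the symmetry of \<open>G\<close>, the
  combination of derivatives in the Christoffel symbol collapses to twice the lowered
  \<open>G\<close>.\<close>

lemma christoffel_unique:
  assumes x: "x \<in> X" and G: "\<And>k i j. G k i j = G k j i"
    and D: "\<And>l i j. partial l (\<lambda>z. a z $ i $ j) x =
      (\<Sum>k\<in>UNIV. a x $ j $ k * G k l i) + (\<Sum>k\<in>UNIV. a x $ i $ k * G k l j)"
  shows "christoffel a x k i j = G k i j"
proof -
  have "(partial i (\<lambda>z. a z $ j $ l) x + partial j (\<lambda>z. a z $ i $ l) x - partial l (\<lambda>z. a z $ i $ j) x) / 2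
     = (\<Sum>k\<in>UNIV. a x $ l $ k * G k i j)" for l
    unfolding D using G[of _ i j] G[of _ i l] G[of _ j l] by (simp add: field_simps)
  then have "christoffel a x k i j = (\<Sum>l\<in>UNIV. matrix_inv (a x) $ k $ l * (\<Sum>h\<in>UNIV. a x $ l $ h * G h i j))"
    by (simp add: christoffel_def sum_divide_distrib flip: times_divide_eq_right)
  then show ?thesis using sum_contract_inv(2)[OF inv[OF x]] by simp
qed

lemma matrix_inv_diff: "x \<in> X \<Longrightarrow> (\<lambda>z. matrix_inv (a z) $ i $ j) differentiable (at x)"
  by (rule differentiable_matrix_inv[OF open_X _ inv diff])

lemma diff_partial: "x \<in> X \<Longrightarrow> partial l (\<lambda>z. a z $ i $ j) differentiable (at x)"
  using smooth_on_partial[OF smooth] by (rule smooth_on_differentiable)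

lemma christoffel_diff: "x \<in> X \<Longrightarrow> (\<lambda>z. christoffel a z k i j) differentiable (at x)"
  unfolding christoffel_def
  by (intro differentiable_divide differentiable_sum differentiable_mult differentiable_add
      differentiable_diff matrix_inv_diff diff_partial differentiable_const ballI) auto

text \<open>This is the derivative of log sqrt |det a|, written without the determinant. The other
  two derivative terms cancel after exchanging \<open>i\<close> and \<open>j\<close>, because the
  inverse matrix is symmetric.\<close>

lemma christoffel_trace:
  assumes "x \<in> X"
  shows "(\<Sum>i\<in>UNIV. christoffel a x i i l) =
    (\<Sum>i\<in>UNIV. \<Sum>j\<in>UNIV. matrix_inv (a x) $ i $ j * partial l (\<lambda>z. a z $ i $ j) x) / 2"
proof -
  let ?J = "matrix_inv (a x)"
  have "(\<Sum>i\<in>UNIV. \<Sum>j\<in>UNIV. ?J $ i $ j * partial j (\<lambda>z. a z $ i $ l) x) =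
     (\<Sum>i\<in>UNIV. \<Sum>j\<in>UNIV. ?J $ i $ j * partial i (\<lambda>z. a z $ l $ j) x)"
    by (subst sum.swap) (simp add: matrix_inv_symmetric[OF inv[OF assms] sym[OF assms], of _ _] partial_sym[OF assms, of _ _ l]
      cong: sum.cong)
  then show ?thesis
    unfolding christoffel_def by (simp add: sum_divide_distrib[symmetric] algebra_simps sum.distrib sum_subtractf)
qed

text \<open>Differentiate A A^-1 = 1 and apply the inverse from the left.\<close>

lemma partial_matrix_inv:
  assumes x: "x \<in> X"
  shows "partial l (\<lambda>z. matrix_inv (a z) $ i $ j) x =
    - (\<Sum>p\<in>UNIV. \<Sum>q\<in>UNIV. matrix_inv (a x) $ i $ p * partial l (\<lambda>z. a z $ p $ q) x * matrix_inv (a x) $ q $ j)"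
proof -
  let ?J = "\<lambda>z. matrix_inv (a z)"
  have "(\<Sum>q\<in>UNIV. a x $ p $ q * partial l (\<lambda>z. ?J z $ q $ j) x) =
      - (\<Sum>q\<in>UNIV. partial l (\<lambda>z. a z $ p $ q) x * ?J x $ q $ j)" for p
  proof -
    have "partial l (\<lambda>z. \<Sum>q\<in>UNIV. a z $ p $ q * ?J z $ q $ j) x =
        partial l (\<lambda>z. if p = j then 1 else 0) x"
      by (rule partial_cong[OF open_X x]) (simp add: matrix_inv_entries(1)[OF inv])
    also have "\<dots> = 0" by (rule partial_const)
    finally have "(\<Sum>q\<in>UNIV. partial l (\<lambda>z. a z $ p $ q) x * ?J x $ q $ j +
        a x $ p $ q * partial l (\<lambda>z. ?J z $ q $ j) x) = 0"
      by (simp add: partial_sum partial_mult differentiable_mult diff matrix_inv_diff x)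
    then show ?thesis by (simp add: sum.distrib)
  qed
  from sum_contract_inv(2)[OF inv[OF x], of i "\<lambda>q. partial l (\<lambda>z. ?J z $ q $ j) x", unfolded this]
  show ?thesis by (simp add: sum_distrib_left sum_negf mult.assoc)
qed

text \<open>Differentiating the trace formula gives a term quadratic in the first derivatives of
  \<open>a\<close>, which is symmetric in \<open>k\<close> and \<open>l\<close> after exchanging (i,
  j) with (p, q), and a term in second derivatives, which commute.\<close>

lemma christoffel_trace_closed:
  assumes x: "x \<in> X"
  shows "partial k (\<lambda>z. \<Sum>i\<in>UNIV. christoffel a z i i l) x =
    partial l (\<lambda>z. \<Sum>i\<in>UNIV. christoffel a z i i k) x"
proof -
  let ?J = "matrix_inv (a x)"
  let ?d = "\<lambda>l i j. partial l (\<lambda>z. a z $ i $ j)"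
  have *: "2 * partial k (\<lambda>z. \<Sum>i\<in>UNIV. christoffel a z i i l) x =
    - (\<Sum>i\<in>UNIV. \<Sum>j\<in>UNIV. \<Sum>p\<in>UNIV. \<Sum>q\<in>UNIV. ?J $ i $ p * ?d k p q x * ?J $ q $ j * ?d l i j x)
    + (\<Sum>i\<in>UNIV. \<Sum>j\<in>UNIV. ?J $ i $ j * partial k (?d l i j) x)" for k l
  proof -
    have "partial k (\<lambda>z. \<Sum>i\<in>UNIV. christoffel a z i i l) x =
        partial k (\<lambda>z. (1/2) * (\<Sum>i\<in>UNIV. \<Sum>j\<in>UNIV. matrix_inv (a z) $ i $ j * ?d l i j z)) x"
      by (rule partial_cong[OF open_X x]) (simp add: christoffel_trace)
    also have "\<dots> = (1/2) * (\<Sum>i\<in>UNIV. \<Sum>j\<in>UNIV.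
      partial k (\<lambda>z. matrix_inv (a z) $ i $ j) x * ?d l i j x + ?J $ i $ j * partial k (?d l i j) x)"
      by (subst partial_cmult)
        (simp_all add: partial_sum partial_mult differentiable_mult matrix_inv_diff diff_partial x)
    finally show ?thesis
      by (simp add: partial_matrix_inv[OF x] sum.distrib sum_subtractf sum_distrib_right sum_negf)
  qed
  have sJ: "?J $ i $ j = ?J $ j $ i" for i j
    by (rule matrix_inv_symmetric[OF inv[OF x] sym[OF x]])
  have "(\<Sum>i\<in>UNIV. \<Sum>j\<in>UNIV. \<Sum>p\<in>UNIV. \<Sum>q\<in>UNIV. ?J $ i $ p * ?d k p q x * ?J $ q $ j * ?d l i j x)
    = (\<Sum>i\<in>UNIV. \<Sum>j\<in>UNIV. \<Sum>p\<in>UNIV. \<Sum>q\<in>UNIV. ?J $ i $ p * ?d l p q x * ?J $ q $ j * ?d k i j x)"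
  proof (subst sum_quad_swap, intro sum.cong refl)
    fix i j p q
    show "?J $ p $ i * ?d k i j x * ?J $ j $ q * ?d l p q x = ?J $ i $ p * ?d l p q x * ?J $ q $ j * ?d k i j x"
      using sJ[of p i] sJ[of j q] by simp
  qed
  moreover have "partial k (?d l i j) x = partial l (?d k i j) x" for i j
    by (rule partial_commute[OF open_X x smooth])
  ultimately show ?thesis using *[of k l] *[of l k] by simp
qed

end

text \<open>Of the four parts of the Ricci tensor, the divergence and the product containing the
  trace are symmetric because \<open>G\<close> is torsion-free. The remaining product is symmetric
  after exchanging its two summation indices. Only the derivative of the trace survives.\<close>

lemma ricci_antisymmetric_part:
  assumes "open X" "x \<in> X" and G: "\<And>z k i j. z \<in> X \<Longrightarrow> G z k i j = G z k j i"
    and D: "\<And>k i j. (\<lambda>z. G z k i j) differentiable (at x)"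
  shows "ricci G x l k - ricci G x k l =
    partial l (\<lambda>z. \<Sum>i\<in>UNIV. G z i i k) x - partial k (\<lambda>z. \<Sum>i\<in>UNIV. G z i i l) x"
proof -
  have "partial i (\<lambda>z. G z i k l) x = partial i (\<lambda>z. G z i l k) x" for i
    by (rule partial_cong[OF assms(1,2)]) (rule G)
  moreover have "G x p k l = G x p l k" for p by (rule G[OF assms(2)])
  moreover have "(\<Sum>i\<in>UNIV. \<Sum>m\<in>UNIV. G x i k m * G x m i l) = (\<Sum>i\<in>UNIV. \<Sum>m\<in>UNIV. G x i l m * G x m i k)"
  proof (subst sum.swap, intro sum.cong refl)
    fix i m
    show "G x m k i * G x i m l = G x i l m * G x m i k"
      using G[OF assms(2), of m k i] G[OF assms(2), of i m l] by simp
  qed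
  ultimately show ?thesis
    by (simp add: ricci_def curvature_def sum.distrib sum_subtractf partial_sum D)
qed

section \<open>The connection attached to \<open>a\<close>, \<open>f\<close> and \<open>m\<close>,
  and its action on \<open>a\<close> and \<open>b\<close>\<close>

definition kropina_connection :: "real \<Rightarrow> (real^'n \<Rightarrow> real^'n^'n) \<Rightarrow> (real^'n \<Rightarrow> real^'n) \<Rightarrow>
    real^'n \<Rightarrow> 'n::finite \<Rightarrow> 'n \<Rightarrow> 'n \<Rightarrow> real" where
  "kropina_connection m a f x k i j = christoffel a x k i j
     + m * (a x $ i $ j * (\<Sum>l\<in>UNIV. matrix_inv (a x) $ k $ l * f x $ l)
            - (if k = j then f x $ i else 0) - (if k = i then f x $ j else 0))"

locale kropina_field = metric_field X a for X :: "(real^'n::finite) set" and a +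
  fixes b f :: "real^'n \<Rightarrow> real^'n" and m :: real
  assumes smooth_b: "smooth_on X (\<lambda>x. b x $ i)"
    and smooth_f: "smooth_on X (\<lambda>x. f x $ i)"
    and berwald: "x \<in> X \<Longrightarrow> cov_deriv (christoffel a) b x j i =
      m * (\<Sum>k\<in>UNIV. \<Sum>l\<in>UNIV. f x $ k * matrix_inv (a x) $ k $ l * b x $ l) * a x $ i $ j
       + b x $ i * f x $ j - m * f x $ i * b x $ j"
begin

abbreviation "\<Gamma> \<equiv> kropina_connection m a f"

lemma diff_b: "x \<in> X \<Longrightarrow> (\<lambda>z. b z $ i) differentiable (at x)"
  using smooth_b by (rule smooth_on_differentiable)

lemma diff_f: "x \<in> X \<Longrightarrow> (\<lambda>z. f z $ i) differentiable (at x)"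
  using smooth_f by (rule smooth_on_differentiable)

lemma connection_sym: "x \<in> X \<Longrightarrow> \<Gamma> x k i j = \<Gamma> x k j i"
  using christoffel_sym[of x k i j] sym[of x i j] by (simp add: kropina_connection_def)

lemma connection_diff: "x \<in> X \<Longrightarrow> (\<lambda>z. \<Gamma> z k i j) differentiable (at x)"
proof -
  assume x: "x \<in> X"
  have *: "(\<lambda>z. if P then f z $ i else 0) differentiable (at x)" for P i
    using diff_f[OF x] by (cases P) auto
  show ?thesis
    unfolding kropina_connection_def
    by (intro differentiable_sum differentiable_mult differentiable_add *
      differentiable_diff matrix_inv_diff diff diff_f christoffel_diff differentiable_const ballI x) auto
qed

text \<open>Stated for an arbitrary covector \<open>c\<close> because it is applied both to the rows
  of \<open>a\<close> and to \<open>b\<close>.\<close>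

lemma contract_connection:
  "(\<Sum>k\<in>UNIV. c k * \<Gamma> x k i j) = (\<Sum>k\<in>UNIV. c k * christoffel a x k i j)
     + m * (a x $ i $ j * (\<Sum>k\<in>UNIV. c k * (\<Sum>l\<in>UNIV. matrix_inv (a x) $ k $ l * f x $ l))
        - c j * f x $ i - c i * f x $ j)"
proof -
  define u where "u k = (\<Sum>l\<in>UNIV. matrix_inv (a x) $ k $ l * f x $ l)" for k
  have "c k * \<Gamma> x k i j = c k * christoffel a x k i j + m * a x $ i $ j * (c k * u k)
      - m * (if k = j then c j * f x $ i else 0) - m * (if k = i then c i * f x $ j else 0)" for k
    unfolding kropina_connection_def u_def[symmetric] by (auto simp: algebra_simps)
  then show ?thesis
    unfolding u_def[symmetric]
    by (simp add: sum.distrib sum_subtractf sum_distrib_left[symmetric]) (simp add: algebra_simps)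
qed

text \<open>The two lowered correction terms are m (a_li f_j - a_ij f_l - a_jl f_i) and the same
  with \<open>i\<close> and \<open>j\<close> exchanged; their sum is -2 m f_l a_ij, which the last
  summand compensates.\<close>

lemma partial_metric_connection:
  assumes "x \<in> X"
  shows "partial l (\<lambda>z. a z $ i $ j) x = (\<Sum>k\<in>UNIV. a x $ j $ k * \<Gamma> x k l i)
    + (\<Sum>k\<in>UNIV. a x $ i $ k * \<Gamma> x k l j) + 2 * m * f x $ l * a x $ i $ j"
  unfolding partial_metric[OF assms] contract_connection sum_contract_inv(1)[OF inv[OF assms]]
  using sym[OF assms, of j i] sym[OF assms, of l i] sym[OF assms, of l j] by (simp add: algebra_simps)

text \<open>Contracting the correction with \<open>b\<close> gives m (f_k b^k) a_il - m f_l b_i - m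
  f_i b_l. Its first and last terms also occur in the Berwald condition, so the difference is (1 +
  m) f_l b_i.\<close>

lemma partial_form_connection:
  assumes "x \<in> X"
  shows "partial l (\<lambda>z. b z $ i) x = (\<Sum>k\<in>UNIV. b x $ k * \<Gamma> x k l i) + (1 + m) * f x $ l * b x $ i"
proof -
  let ?fb = "\<Sum>k\<in>UNIV. \<Sum>l\<in>UNIV. f x $ k * matrix_inv (a x) $ k $ l * b x $ l"
  have "(\<Sum>k\<in>UNIV. b x $ k * (\<Sum>l\<in>UNIV. matrix_inv (a x) $ k $ l * f x $ l)) =
    (\<Sum>k\<in>UNIV. \<Sum>l\<in>UNIV. f x $ l * matrix_inv (a x) $ l $ k * b x $ k)"
    using matrix_inv_symmetric[OF inv[OF assms] sym[OF assms]]
    by (simp add: sum_distrib_left mult_ac)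
  also have "\<dots> = ?fb" by (rule sum.swap)
  finally have fb: "(\<Sum>k\<in>UNIV. b x $ k * (\<Sum>l\<in>UNIV. matrix_inv (a x) $ k $ l * f x $ l)) = ?fb" .
  show ?thesis
    using berwald[OF assms, of l i] sym[OF assms, of l i] unfolding cov_deriv_def contract_connection fb
    by (simp add: algebra_simps)
qed

text \<open>In the trace, the term with the raised \<open>f\<close> contributes m f_l, the first
  delta contributes -m f_l, and the second contributes -m f_l once for every value of the summed
  index.\<close>

lemma connection_trace:
  assumes "x \<in> X"
  shows "(\<Sum>i\<in>UNIV. \<Gamma> x i i l) = (\<Sum>i\<in>UNIV. christoffel a x i i l) - m * real CARD('n) * f x $ l"
proof -
  define u where "u k = (\<Sum>l\<in>UNIV. matrix_inv (a x) $ k $ l * f x $ l)" for k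
  have "(\<Sum>i\<in>UNIV. a x $ l $ i * u i) = f x $ l"
    unfolding u_def by (rule sum_contract_inv(1)[OF inv[OF assms]])
  then have "(\<Sum>i\<in>UNIV. m * (a x $ i $ l * u i)) = m * f x $ l"
    by (simp add: sym[OF assms, of l] sum_distrib_left[symmetric])
  moreover have "\<Gamma> x i i l = christoffel a x i i l + m * (a x $ i $ l * u i)
      - m * (if i = l then f x $ i else 0) - m * f x $ l" for i
    unfolding kropina_connection_def u_def[symmetric] by (auto simp: algebra_simps)
  ultimately show ?thesis
    by (simp add: sum.distrib sum_subtractf sum_distrib_left[symmetric])
qed

lemma ricci_symmetric_iff:
  assumes x: "x \<in> X" and "m \<noteq> 0"
  shows "ricci \<Gamma> x k l = ricci \<Gamma> x l k \<longleftrightarrow> partial k (\<lambda>z. f z $ l) x = partial l (\<lambda>z. f z $ k) x"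
proof -
  have *: "partial k (\<lambda>z. \<Sum>i\<in>UNIV. \<Gamma> z i i l) x =
      partial k (\<lambda>z. \<Sum>i\<in>UNIV. christoffel a z i i l) x - m * real CARD('n) * partial k (\<lambda>z. f z $ l) x" for k l
  proof -
    have "partial k (\<lambda>z. \<Sum>i\<in>UNIV. \<Gamma> z i i l) x =
       partial k (\<lambda>z. (\<Sum>i\<in>UNIV. christoffel a z i i l) + (- m * real CARD('n)) * f z $ l) x"
      by (rule partial_cong[OF open_X x]) (simp add: connection_trace)
    also have "\<dots> = partial k (\<lambda>z. \<Sum>i\<in>UNIV. christoffel a z i i l) x
        + (- m * real CARD('n)) * partial k (\<lambda>z. f z $ l) x"
      unfolding partial_cmult[OF diff_f[OF x], symmetric]
      by (rule partial_add) (simp_all add: christoffel_diff diff_f x)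
    finally show ?thesis by simp
  qed
  have "ricci \<Gamma> x k l - ricci \<Gamma> x l k =
    m * real CARD('n) * (partial l (\<lambda>z. f z $ k) x - partial k (\<lambda>z. f z $ l) x)"
    by (simp add: ricci_antisymmetric_part[OF open_X x connection_sym connection_diff[OF x]] *
      christoffel_trace_closed[OF x, of k l] algebra_simps)
  then show ?thesis using \<open>m \<noteq> 0\<close> by auto
qed

text \<open>The derivative of the factor contributes -2 m f_l a'_ij, exactly cancelling the failure
  of \<open>\<Gamma>\<close> to be compatible with \<open>a\<close>. Being torsion-free and
  compatible with \<open>a'\<close>, \<open>\<Gamma>\<close> is its Levi-Civita connection.\<close>

lemma christoffel_conformal:
  assumes "metric_field Y a'" "Y \<subseteq> X" "x \<in> Y"
    and a': "\<And>z i j. z \<in> Y \<Longrightarrow> a' z $ i $ j = exp (- 2 * m * \<psi> z) * a z $ i $ j"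
    and \<psi>: "\<psi> differentiable (at x)" "\<And>i. partial i \<psi> x = f x $ i"
  shows "christoffel a' x k i j = \<Gamma> x k i j"
proof -
  interpret c: metric_field Y a' by fact
  have x: "x \<in> X" using assms by auto
  have e: "((\<lambda>z. exp (- 2 * m * \<psi> z)) has_derivative
      (\<lambda>v. - 2 * m * exp (- 2 * m * \<psi> x) * frechet_derivative \<psi> (at x) v)) (at x)"
    using \<psi>(1)[unfolded frechet_derivative_works] by (auto intro!: derivative_eq_intros)
  have "partial l (\<lambda>z. a' z $ i $ j) x =
    (\<Sum>k\<in>UNIV. a' x $ j $ k * \<Gamma> x k l i) + (\<Sum>k\<in>UNIV. a' x $ i $ k * \<Gamma> x k l j)" for l i j
  proof -
    have "partial l (\<lambda>z. a' z $ i $ j) x = partial l (\<lambda>z. exp (- 2 * m * \<psi> z) * a z $ i $ j) x"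
      by (rule partial_cong[OF c.open_X \<open>x \<in> Y\<close> a'])
    also have "\<dots> = partial l (\<lambda>z. exp (- 2 * m * \<psi> z)) x * a x $ i $ j
        + exp (- 2 * m * \<psi> x) * partial l (\<lambda>z. a z $ i $ j) x"
      by (rule partial_mult[OF differentiableI[OF e] diff[OF x]])
    also have "partial l (\<lambda>z. exp (- 2 * m * \<psi> z)) x = - 2 * m * exp (- 2 * m * \<psi> x) * f x $ l"
      using partial_eqI[OF e] \<psi>(2) by (simp add: partial_def)
    finally show ?thesis
      unfolding partial_metric_connection[OF x]
      by (simp add: a' \<open>x \<in> Y\<close> algebra_simps sum_distrib_left)
  qed
  then show ?thesis
    by (rule c.christoffel_unique[OF \<open>x \<in> Y\<close> connection_sym[OF x]])
qed

text \<open>The factor now has to cancel the weight 1 + m of \<open>b\<close>. A covariant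
  derivative uses the connection only at the point itself, so \<open>G\<close> has to agree with
  \<open>\<Gamma>\<close> only at \<open>x\<close>.\<close>

lemma cov_deriv_conformal:
  assumes x: "x \<in> X" and "open Y" "x \<in> Y"
    and b': "\<And>z i. z \<in> Y \<Longrightarrow> b' z $ i = exp (- (1 + m) * \<psi> z) * b z $ i"
    and \<psi>: "\<psi> differentiable (at x)" "\<And>i. partial i \<psi> x = f x $ i"
    and G: "\<And>k i j. G x k i j = \<Gamma> x k i j"
  shows "cov_deriv G b' x j i = 0"
proof -
  have e: "((\<lambda>z. exp (- (1 + m) * \<psi> z)) has_derivative
      (\<lambda>v. - (1 + m) * exp (- (1 + m) * \<psi> x) * frechet_derivative \<psi> (at x) v)) (at x)"
    using \<psi>(1)[unfolded frechet_derivative_works] by (auto intro!: derivative_eq_intros simp: algebra_simps)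
  have "partial j (\<lambda>z. b' z $ i) x = partial j (\<lambda>z. exp (- (1 + m) * \<psi> z) * b z $ i) x"
    by (rule partial_cong[OF \<open>open Y\<close> \<open>x \<in> Y\<close> b'])
  also have "\<dots> = partial j (\<lambda>z. exp (- (1 + m) * \<psi> z)) x * b x $ i
      + exp (- (1 + m) * \<psi> x) * partial j (\<lambda>z. b z $ i) x"
    by (rule partial_mult[OF differentiableI[OF e] diff_b[OF x]])
  also have "partial j (\<lambda>z. exp (- (1 + m) * \<psi> z)) x = - (1 + m) * exp (- (1 + m) * \<psi> x) * f x $ j"
    using partial_eqI[OF e] \<psi>(2) by (simp add: partial_def)
  finally show ?thesis
    unfolding partial_form_connection[OF x] cov_deriv_def
    by (simp add: b' \<open>x \<in> Y\<close> G algebra_simps sum_distrib_left)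
qed

end

section \<open>Potentials of closed fields on balls\<close>

text \<open>The Poincare lemma on a ball: the potential at \<open>x\<close> is the line integral of
  \<open>w\<close> along the radius from the centre to \<open>x\<close>, differentiated under the
  integral sign.\<close>

lemma closed_field_potential:
  fixes w :: "real^'n::finite \<Rightarrow> real^'n"
  assumes smooth: "\<And>i. smooth_on (ball c r) (\<lambda>x. w x $ i)"
    and closed: "\<And>x i j. x \<in> ball c r \<Longrightarrow> partial i (\<lambda>z. w z $ j) x = partial j (\<lambda>z. w z $ i) x"
  obtains \<psi> where "\<And>x. x \<in> ball c r \<Longrightarrow> (\<psi> has_derivative (\<lambda>v. w x \<bullet> v)) (at x)"
proof -
  define \<gamma> where "\<gamma> x t = c + t *\<^sub>R (x - c)" for x t
  \<comment> \<open>\<open>K\<close> has two readings: it is the derivative in \<open>t\<close> of t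
    w(gamma x t), and, by closedness, the gradient in \<open>x\<close> of the integrand of
    \<open>\<psi>\<close>. Hence the integral of the gradient telescopes to
    \<open>w x\<close>.\<close>
  define K where "K x t = w (\<gamma> x t) + t *\<^sub>R (\<chi> i. \<Sum>j\<in>UNIV. (x - c) $ j * partial j (\<lambda>z. w z $ i) (\<gamma> x t))" for x t
  define \<psi> where "\<psi> x = integral (cbox 0 1) (\<lambda>t. w (\<gamma> x t) \<bullet> (x - c))" for x
  have \<gamma>: "\<gamma> x t \<in> ball c r" if "x \<in> ball c r" "t \<in> cbox 0 1" for x t
  proof -
    have "norm (t *\<^sub>R (x - c)) \<le> norm (x - c)"
      using that by (auto simp: mult_left_le_one_le)
    also have "\<dots> < r" using that by (simp add: dist_norm norm_minus_commute)
    finally show ?thesis by (simp add: \<gamma>_def dist_norm)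
  qed
  have dw: "((\<lambda>z. w z $ i) has_derivative (\<lambda>v. \<Sum>j\<in>UNIV. v $ j * partial j (\<lambda>z. w z $ i) x)) (at x)"
    if "x \<in> ball c r" for x i
  proof -
    have d: "(\<lambda>z. w z $ i) differentiable (at x)"
      by (rule smooth_on_differentiable[OF smooth that])
    show ?thesis
      using d[unfolded frechet_derivative_works] unfolding frechet_derivative_partials[OF d, abs_def] .
  qed
  have cw: "continuous_on (ball c r) (\<lambda>x. w x $ i)" for i
    using smooth_onD[OF smooth, of 0] by simp
  have cp: "continuous_on (ball c r) (partial j (\<lambda>x. w x $ i))" for i j
    using smooth_onD[OF smooth_on_partial[OF smooth], of 0] by simp
  have cg: "continuous_on (ball c r \<times> cbox 0 1) (\<lambda>p. h (\<gamma> (fst p) (snd p)))"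
    if "continuous_on (ball c r) h" for h :: "real^'n \<Rightarrow> real"
    by (rule continuous_on_compose2[OF that])
      (auto simp: \<gamma>_def[symmetric] intro!: \<gamma> continuous_intros, auto simp: \<gamma>_def intro!: continuous_intros)
  have cK: "continuous_on (ball c r \<times> cbox 0 1) (\<lambda>p. K (fst p) (snd p) $ i)" for i
  proof -
    have "K x t $ i = w (\<gamma> x t) $ i + t * (\<Sum>j\<in>UNIV. (x - c) $ j * partial j (\<lambda>z. w z $ i) (\<gamma> x t))" for x t
      by (simp add: K_def)
    then show ?thesis
      by (simp only:) (rule continuous_on_add[OF cg[OF cw] continuous_on_mult[OF _ continuous_on_sum]],
        (intro continuous_intros cg[OF cp])+)
  qed
  have cK': "continuous_on (ball c r \<times> cbox 0 1) (\<lambda>(x, t). K x t)"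
    unfolding case_prod_unfold continuous_on_componentwise[of _ "\<lambda>p. K (fst p) (snd p)"]
    by (auto simp: Basis_vec_def inner_axis intro: cK[simplified])
  have dcomp: "((\<lambda>x. w (\<gamma> x t) $ i) has_derivative
      (\<lambda>v. \<Sum>j\<in>UNIV. (t * v $ j) * partial j (\<lambda>z. w z $ i) (\<gamma> x t))) (at x)"
    if "x \<in> ball c r" "t \<in> cbox 0 1" for x t i
  proof -
    have "((\<lambda>x. \<gamma> x t) has_derivative (\<lambda>v. t *\<^sub>R v)) (at x)"
      unfolding \<gamma>_def by (auto intro!: derivative_eq_intros)
    from has_derivative_compose[OF this dw[OF \<gamma>[OF that]]] show ?thesis by simp
  qed
  have dtime: "((\<lambda>t. w (\<gamma> x t) $ i) has_real_derivative
      (\<Sum>j\<in>UNIV. (x - c) $ j * partial j (\<lambda>z. w z $ i) (\<gamma> x t))) (at t)"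
    if "x \<in> ball c r" "t \<in> cbox 0 1" for x t i
  proof -
    have "((\<lambda>t. \<gamma> x t) has_derivative (\<lambda>d. d *\<^sub>R (x - c))) (at t)"
      unfolding \<gamma>_def by (auto intro!: derivative_eq_intros)
    from has_derivative_compose[OF this dw[OF \<gamma>[OF that]]] show ?thesis
      unfolding has_field_derivative_def
      by (rule has_derivative_eq_rhs) (simp add: fun_eq_iff sum_distrib_left sum_distrib_right mult_ac)
  qed
  have dspace: "((\<lambda>x. w (\<gamma> x t) \<bullet> (x - c)) has_derivative (\<lambda>v. K x t \<bullet> v)) (at x)"
    if "x \<in> ball c r" "t \<in> cbox 0 1" for x t
  proof -
    have 1: "((\<lambda>x. (x - c) $ i) has_derivative (\<lambda>v. v $ i)) (at x)" for i
      by (auto intro!: derivative_eq_intros bounded_linear_imp_has_derivative bounded_linear_vec_nth)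
    have "((\<lambda>x. w (\<gamma> x t) \<bullet> (x - c)) has_derivative (\<lambda>v. \<Sum>i\<in>UNIV. w (\<gamma> x t) $ i * v $ i +
       (\<Sum>j\<in>UNIV. (t * v $ j) * partial j (\<lambda>z. w z $ i) (\<gamma> x t)) * (x - c) $ i)) (at x)"
      unfolding inner_vec_def inner_real_def
      by (intro has_derivative_sum has_derivative_mult dcomp that 1)
    moreover have "(\<Sum>i\<in>UNIV. w (\<gamma> x t) $ i * v $ i +
       (\<Sum>j\<in>UNIV. (t * v $ j) * partial j (\<lambda>z. w z $ i) (\<gamma> x t)) * (x - c) $ i) = K x t \<bullet> v" for v
    proof -
      \<comment> \<open>Closedness enters here, exchanging the two indices of the derivative of
        \<open>w\<close>.\<close>
      have "(\<Sum>i\<in>UNIV. (\<Sum>j\<in>UNIV. (t * v $ j) * partial j (\<lambda>z. w z $ i) (\<gamma> x t)) * (x - c) $ i) =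
        (\<Sum>i\<in>UNIV. \<Sum>j\<in>UNIV. (t * v $ j) * partial i (\<lambda>z. w z $ j) (\<gamma> x t) * (x - c) $ i)"
        using closed[OF \<gamma>[OF that]] by (simp add: sum_distrib_right)
      also have "\<dots> = (\<Sum>j\<in>UNIV. \<Sum>i\<in>UNIV. (t * v $ j) * partial i (\<lambda>z. w z $ j) (\<gamma> x t) * (x - c) $ i)"
        by (rule sum.swap)
      finally show ?thesis
        by (simp add: K_def inner_vec_def sum.distrib algebra_simps sum_distrib_left sum_distrib_right)
    qed
    ultimately show ?thesis by simp
  qed
  have intK: "((\<lambda>t. K x t \<bullet> v) has_integral w x \<bullet> v) (cbox 0 1)" if "x \<in> ball c r" for x v
  proof -
    have "((\<lambda>t. t * (w (\<gamma> x t) \<bullet> v)) has_vector_derivative K x t \<bullet> v) (at t within {0..1})"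
      if "t \<in> {0..1}" for t
    proof -
      have "((\<lambda>t. \<Sum>i\<in>UNIV. w (\<gamma> x t) $ i * v $ i) has_real_derivative
        (\<Sum>i\<in>UNIV. (\<Sum>j\<in>UNIV. (x - c) $ j * partial j (\<lambda>z. w z $ i) (\<gamma> x t)) * v $ i)) (at t)"
        using that \<open>x \<in> ball c r\<close> by (intro DERIV_sum DERIV_cmult_right dtime) auto
      then have "((\<lambda>t. t * (\<Sum>i\<in>UNIV. w (\<gamma> x t) $ i * v $ i)) has_real_derivative K x t \<bullet> v) (at t)"
        by (rule DERIV_cong[OF DERIV_mult[OF DERIV_ident]])
          (simp add: K_def inner_vec_def sum.distrib algebra_simps sum_distrib_left sum_distrib_right)
      then show ?thesis
        by (simp add: inner_vec_def has_real_derivative_iff_has_vector_derivative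
          has_vector_derivative_at_within)
    qed
    from fundamental_theorem_of_calculus[OF _ this] show ?thesis by (simp add: \<gamma>_def)
  qed
  have "(\<psi> has_derivative (\<lambda>v. w x \<bullet> v)) (at x)" if x: "x \<in> ball c r" for x
  proof -
    \<comment> \<open>\<open>leibniz_rule\<close> expects the derivative as a continuous family of
      bounded linear maps, so the gradient \<open>K x t\<close> is packaged as the functional it
      represents.\<close>
    let ?B = "\<lambda>x t. blinfun_inner_left (K x t)"
    have "(\<psi> has_derivative integral (cbox 0 1) (?B x)) (at x within ball c r)"
      unfolding \<psi>_def
    proof (rule leibniz_rule)
      fix x t assume *: "x \<in> ball c r" "t \<in> cbox 0 (1::real)"
      show "((\<lambda>x. w (\<gamma> x t) \<bullet> (x - c)) has_derivative ?B x t) (at x within ball c r)"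
        using has_derivative_at_withinI[OF dspace[OF *]] by (simp add: inner_commute)
    next
      fix x assume *: "x \<in> ball c r"
      have "continuous_on (cbox 0 1) (\<lambda>t. w (\<gamma> x t) $ i)" for i
        using dtime[OF *] by (intro continuous_at_imp_continuous_on ballI DERIV_isCont) blast
      then show "(\<lambda>t. w (\<gamma> x t) \<bullet> (x - c)) integrable_on cbox 0 1"
        unfolding inner_vec_def inner_real_def
        by (intro integrable_continuous continuous_on_sum continuous_on_mult continuous_on_const)
    next
      show "continuous_on (ball c r \<times> cbox 0 1) (\<lambda>(x, t). ?B x t)"
        using cK' by (auto simp: case_prod_unfold intro!: continuous_intros)
    qed (use x in auto)
    moreover have "blinfun_apply (integral (cbox 0 1) (?B x)) = (\<lambda>v. w x \<bullet> v)"
    proof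
      fix v
      have "continuous_on (cbox 0 1) (\<lambda>t. case (x, t) of (x, t) \<Rightarrow> K x t)"
        by (rule continuous_on_compose2[OF cK']) (use x in \<open>auto intro!: continuous_intros\<close>)
      then have "?B x integrable_on cbox 0 1"
        by (intro integrable_continuous continuous_intros) auto
      then have "integral (cbox 0 1) (?B x) v = integral (cbox 0 1) (\<lambda>t. ?B x t v)"
        by (simp add: blinfun_apply_integral)
      then show "integral (cbox 0 1) (?B x) v = w x \<bullet> v"
        using integral_unique[OF intK[OF x, of v]] by (simp add: inner_commute)
    qed
    ultimately show ?thesis
      by (simp only: at_within_open[OF x open_ball])
  qed
  then show ?thesis by (rule that)
qed

section \<open>The spray of a horizontally constant function\<close>

text \<open>Expresses slice derivatives through the total derivative on the product, so that
  symmetry of second derivatives can be applied to one base and one fibre direction.\<close>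

lemma
  fixes h :: "(real^'n::finite) \<times> (real^'n) \<Rightarrow> real"
  assumes "h differentiable (at (x, u))"
  shows partial_fst: "partial l (\<lambda>z. h (z, u)) x = frechet_derivative h (at (x, u)) (axis l 1, 0)"
    and partial_snd: "partial l (\<lambda>w. h (x, w)) u = frechet_derivative h (at (x, u)) (0, axis l 1)"
    and differentiable_snd: "(\<lambda>w. h (x, w)) differentiable (at u)"
proof -
  note d = assms[unfolded frechet_derivative_works]
  have 1: "((\<lambda>z. h (z, u)) has_derivative (\<lambda>v. frechet_derivative h (at (x, u)) (v, 0))) (at x)"
    by (rule has_derivative_compose[of "\<lambda>z. (z, u)" _ x UNIV h, OF _ d]) (auto intro!: derivative_eq_intros)
  have 2: "((\<lambda>w. h (x, w)) has_derivative (\<lambda>v. frechet_derivative h (at (x, u)) (0, v))) (at u)"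
    by (rule has_derivative_compose[of "\<lambda>w. (x, w)" _ u UNIV h, OF _ d]) (auto intro!: derivative_eq_intros)
  show "partial l (\<lambda>z. h (z, u)) x = frechet_derivative h (at (x, u)) (axis l 1, 0)"
    using partial_eqI[OF 1] .
  show "partial l (\<lambda>w. h (x, w)) u = frechet_derivative h (at (x, u)) (0, axis l 1)"
    using partial_eqI[OF 2] .
  show "(\<lambda>w. h (x, w)) differentiable (at u)"
    using 2 by (auto simp: differentiable_def)
qed

lemma open_slices:
  assumes "open D"
  shows "open {w. (x, w) \<in> D}" "open {z. (z, w) \<in> D}"
  using open_vimage[OF assms, of "\<lambda>w. (x, w)"] open_vimage[OF assms, of "\<lambda>z. (z, w)"]
  by (simp_all add: vimage_def continuous_on_Pair)

lemma partial_coordinate: "partial i (\<lambda>u. u $ p) y = (if i = p then 1 else 0)"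
  by (subst partial_eqI[of _ "\<lambda>v. v $ p"]) (auto simp: axis_def intro!: bounded_linear_imp_has_derivative bounded_linear_vec_nth)

lemma differentiable_coordinate: "(\<lambda>u. u $ p) differentiable (at (y :: real^'n::finite))"
  by (rule bounded_linear_imp_differentiable[OF bounded_linear_vec_nth])

text \<open>If the torsion-free connection \<open>G\<close> annihilates \<open>L\<^sup>2\<close>, differentiating this condition along
  the fibre expresses the right-hand side of the geodesic equation through \<open>G\<close>.\<close>

lemma nonlinear_connection_horizontal:
  fixes L :: "real^'n::finite \<Rightarrow> real^'n \<Rightarrow> real"
  assumes D: "open D" and smooth: "smooth_on D (\<lambda>(x, y). (L x y)\<^sup>2)"
    and G: "\<And>k i j. G k i j = G k j i"
    and hor: "\<And>l y. (x, y) \<in> D \<Longrightarrow> partial l (\<lambda>z. (L z y)\<^sup>2) x =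
      (\<Sum>j\<in>UNIV. (\<Sum>p\<in>UNIV. G j l p * y $ p) * partial j (\<lambda>w. (L x w)\<^sup>2) y)"
    and nondeg: "\<And>y. (x, y) \<in> D \<Longrightarrow> invertible (fundamental_tensor L x y)"
    and y: "(x, y) \<in> D"
  shows "nonlinear_connection L x y j i = (\<Sum>p\<in>UNIV. G j i p * y $ p)"
proof -
  define h where "h = (\<lambda>(x, y). (L x y)\<^sup>2)"
  define dv where "dv j u = partial j (\<lambda>w. (L x w)\<^sup>2) u" for j u
  define S where "S j u = (\<Sum>l\<in>UNIV. \<Sum>p\<in>UNIV. G j l p * u $ l * u $ p)" for j u
  have h: "smooth_on D h" using smooth by (simp add: h_def)
  have hd: "h differentiable (at q)" if "q \<in> D" for q
    by (rule smooth_on_differentiable[OF h that])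
  have hd2: "(\<lambda>q. frechet_derivative h (at q) v) differentiable (at q)" if "q \<in> D" for q v
    using smooth_onD[OF h, of "Suc (Suc 0)"] that by (metis Ck_on.simps(2))
  have L: "(L z w)\<^sup>2 = h (z, w)" for z w by (simp add: h_def)
  have dvd: "dv j differentiable (at u)" if "(x, u) \<in> D" for j u
  proof (rule differentiable_cong_open[OF open_slices(1)[OF D]])
    show "u \<in> {w. (x, w) \<in> D}" using that by simp
    show "(\<lambda>u. frechet_derivative h (at (x, u)) (0, axis j 1)) differentiable (at u)"
      by (rule differentiable_snd[OF hd2[OF that]])
  qed (simp add: dv_def L partial_snd hd)
  have fund: "2 * fundamental_tensor L x u $ k $ j = partial k (dv j) u" if "(x, u) \<in> D" for u k j
  proof -
    have "partial k (\<lambda>u. partial j (\<lambda>w. (L x w)\<^sup>2 / 2) u) u = partial k (\<lambda>u. (1/2) * dv j u) u"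
    proof (rule partial_cong[OF open_slices(1)[OF D]])
      fix z assume "z \<in> {w. (x, w) \<in> D}"
      then have "(\<lambda>w. (L x w)\<^sup>2) differentiable (at z)"
        unfolding L by (auto intro: differentiable_snd hd)
      from partial_cmult[OF this, of j "1/2"] show "partial j (\<lambda>w. (L x w)\<^sup>2 / 2) z = 1/2 * dv j z"
        by (simp add: dv_def)
    qed (use that in simp)
    also have "\<dots> = 1/2 * partial k (dv j) u" by (rule partial_cmult[OF dvd[OF that]])
    finally show ?thesis by (simp add: fundamental_tensor_def)
  qed
  \<comment> \<open>The horizontality condition is known only over the point \<open>x\<close>, for
    all fibre vectors there. The base derivative is therefore moved inside the fibre derivative
    before the condition is used.\<close>
  have mixed: "partial l (\<lambda>z. partial k (\<lambda>w. (L z w)\<^sup>2) u) x =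
    (\<Sum>j\<in>UNIV. G j l k * dv j u + (\<Sum>p\<in>UNIV. G j l p * u $ p) * partial k (dv j) u)"
    if "(x, u) \<in> D" for l k u
  proof -
    have "partial l (\<lambda>z. partial k (\<lambda>w. (L z w)\<^sup>2) u) x =
      partial l (\<lambda>z. frechet_derivative h (at (z, u)) (0, axis k 1)) x"
      by (rule partial_cong[OF open_slices(2)[OF D, of u]]) (auto simp: that L partial_snd hd)
    also have "\<dots> = frechet_derivative (\<lambda>q. frechet_derivative h (at q) (0, axis k 1)) (at (x, u)) (axis l 1, 0)"
      by (rule partial_fst[OF hd2[OF that]])
    also have "\<dots> = frechet_derivative (\<lambda>q. frechet_derivative h (at q) (axis l 1, 0)) (at (x, u)) (0, axis k 1)"
      by (rule mixed_derivative_commute[OF D that smooth_onD[OF h]])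
    also have "\<dots> = partial k (\<lambda>w. frechet_derivative h (at (x, w)) (axis l 1, 0)) u"
      by (rule partial_snd[OF hd2[OF that], symmetric])
    also have "\<dots> = partial k (\<lambda>w. \<Sum>j\<in>UNIV. (\<Sum>p\<in>UNIV. G j l p * w $ p) * dv j w) u"
    proof (rule partial_cong[OF open_slices(1)[OF D]])
      fix z assume "z \<in> {w. (x, w) \<in> D}"
      then have z: "(x, z) \<in> D" by simp
      show "frechet_derivative h (at (x, z)) (axis l 1, 0) = (\<Sum>j\<in>UNIV. (\<Sum>p\<in>UNIV. G j l p * z $ p) * dv j z)"
        using hor[OF z] by (simp add: dv_def L partial_fst[OF hd[OF z]])
    qed (use that in simp)
    also have "\<dots> = (\<Sum>j\<in>UNIV. G j l k * dv j u + (\<Sum>p\<in>UNIV. G j l p * u $ p) * partial k (dv j) u)"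
      using dvd[OF that]
      by (simp add: partial_sum partial_mult differentiable_mult differentiable_coordinate
        partial_coordinate partial_const if_distrib cong: if_cong)
    finally show ?thesis .
  qed
  have geodesic: "(\<Sum>k\<in>UNIV. matrix_inv (fundamental_tensor L x u) $ j $ k *
        ((\<Sum>l\<in>UNIV. u $ l * partial l (\<lambda>z. partial k (\<lambda>w. (L z w)\<^sup>2) u) x)
           - partial k (\<lambda>z. (L z u)\<^sup>2) x)) = 4 * S j u / 2" if u: "(x, u) \<in> D" for u j
  proof -
    \<comment> \<open>In the mixed derivative, the terms with a first derivative of
      \<open>L^2\<close> reproduce, by horizontality and the symmetry of \<open>G\<close>, the base
      derivative being subtracted. What remains is the fundamental tensor applied to 2 S, and the
      inverse in the geodesic formula removes it.\<close>
    have "(\<Sum>l\<in>UNIV. u $ l * partial l (\<lambda>z. partial k (\<lambda>w. (L z w)\<^sup>2) u) x) - partial k (\<lambda>z. (L z u)\<^sup>2) x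
      = (\<Sum>h\<in>UNIV. fundamental_tensor L x u $ k $ h * (2 * S h u))" for k
    proof -
      have "(\<Sum>l\<in>UNIV. u $ l * partial l (\<lambda>z. partial k (\<lambda>w. (L z w)\<^sup>2) u) x) =
        (\<Sum>l\<in>UNIV. \<Sum>j\<in>UNIV. u $ l * (G j l k * dv j u)) +
        (\<Sum>l\<in>UNIV. \<Sum>j\<in>UNIV. u $ l * ((\<Sum>p\<in>UNIV. G j l p * u $ p) * partial k (dv j) u))"
        by (simp add: mixed[OF u] sum_distrib_left sum.distrib distrib_left)
      also have "(\<Sum>l\<in>UNIV. \<Sum>j\<in>UNIV. u $ l * (G j l k * dv j u)) = partial k (\<lambda>z. (L z u)\<^sup>2) x"
        unfolding hor[OF u] dv_def[symmetric]
        by (subst sum.swap) (simp add: sum_distrib_left sum_distrib_right G[of _ k] mult_ac)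
      also have "(\<Sum>l\<in>UNIV. \<Sum>j\<in>UNIV. u $ l * ((\<Sum>p\<in>UNIV. G j l p * u $ p) * partial k (dv j) u)) =
         (\<Sum>j\<in>UNIV. partial k (dv j) u * S j u)"
        unfolding S_def
        by (subst sum.swap) (simp add: sum_distrib_left sum_distrib_right mult_ac)
      finally show ?thesis by (simp add: fund[OF u, symmetric] mult_ac)
    qed
    then show ?thesis
      by (simp only: sum_contract_inv(2)[OF nondeg[OF u]])
  qed
  \<comment> \<open>Symmetry of \<open>G\<close> makes the fibre derivative of the quadratic
    \<open>S\<close> twice the linear expression wanted; the factor 2 before \<open>S\<close> makes
    up the rest of the divisor 4.\<close>
  have "nonlinear_connection L x y j i = partial i (\<lambda>u. 2 * S j u) y / 4"
    unfolding nonlinear_connection_def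
    by (subst partial_cong[OF open_slices(1)[OF D], of y x _ "\<lambda>u. 2 * S j u"]) (auto simp: y geodesic)
  also have "partial i (\<lambda>u. 2 * S j u) y = 4 * (\<Sum>p\<in>UNIV. G j i p * y $ p)"
  proof -
    have "partial i (\<lambda>u. 2 * S j u) y = 2 * (\<Sum>l\<in>UNIV. \<Sum>p\<in>UNIV.
       G j l p * (if i = l then 1 else 0) * y $ p + G j l p * y $ l * (if i = p then 1 else 0))"
      unfolding S_def
      by (subst partial_cmult) (simp_all add: partial_sum partial_mult differentiable_mult
        differentiable_coordinate partial_coordinate partial_const)
    also have "(\<Sum>l\<in>UNIV. \<Sum>p\<in>UNIV.
        G j l p * (if i = l then 1 else 0) * y $ p + G j l p * y $ l * (if i = p then 1 else 0)) =
      (\<Sum>l\<in>UNIV. \<Sum>p\<in>UNIV.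
        (if i = l then G j l p * y $ p else 0) + (if i = p then G j p l * y $ l else 0))"
    proof (intro sum.cong refl)
      fix l p
      show "G j l p * (if i = l then 1 else 0) * y $ p + G j l p * y $ l * (if i = p then 1 else 0) =
        (if i = l then G j l p * y $ p else 0) + (if i = p then G j p l * y $ l else 0)"
        using G[of j l i] by auto
    qed
    also have "\<dots> = (\<Sum>l\<in>UNIV. \<Sum>p\<in>UNIV. if i = l then G j l p * y $ p else 0)
        + (\<Sum>l\<in>UNIV. \<Sum>p\<in>UNIV. if i = p then G j p l * y $ l else 0)"
      by (simp add: sum.distrib)
    also have "(\<Sum>l\<in>UNIV. \<Sum>p\<in>UNIV. if i = l then G j l p * y $ p else 0) = (\<Sum>p\<in>UNIV. G j i p * y $ p)"
      by (subst sum.swap) simp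
    finally show ?thesis by simp
  qed
  finally show ?thesis by simp
qed

text \<open>Dividing |h|^s by \<open>h\<close> itself, instead of lowering the exponent, supplies
  the sign of \<open>h\<close> and gives one formula on both sides of zero.\<close>

lemma has_derivative_abs_powr:
  fixes h :: "'a::real_normed_vector \<Rightarrow> real"
  assumes "(h has_derivative h') (at x)" "h x \<noteq> 0"
  shows "((\<lambda>z. \<bar>h z\<bar> powr s) has_derivative (\<lambda>v. s * \<bar>h x\<bar> powr s / h x * h' v)) (at x)"
proof -
  have "((\<lambda>t. \<bar>t\<bar> powr s) has_real_derivative s * \<bar>t\<bar> powr s / t) (at t)" if "t \<noteq> 0" for t :: real
  proof (cases "t > 0")
    case True
    have "((\<lambda>t. t powr s) has_real_derivative s * t powr (s - 1)) (at t)"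
      using True by (auto intro!: derivative_eq_intros)
    moreover have "s * t powr (s - 1) = s * \<bar>t\<bar> powr s / t"
      using True by (simp add: powr_diff)
    ultimately have "((\<lambda>t. t powr s) has_real_derivative s * \<bar>t\<bar> powr s / t) (at t)" by simp
    then show ?thesis
      by (rule has_field_derivative_transform_within_open[of _ _ _ "{0<..}"]) (use True in auto)
  next
    case False
    then have t: "t < 0" using that by simp
    have "((\<lambda>t. (- t) powr s) has_real_derivative - (s * (- t) powr (s - 1))) (at t)"
      using t by (auto intro!: derivative_eq_intros)
    moreover have "- (s * (- t) powr (s - 1)) = s * \<bar>t\<bar> powr s / t"
      using t by (simp add: powr_diff)
    ultimately have "((\<lambda>t. (- t) powr s) has_real_derivative s * \<bar>t\<bar> powr s / t) (at t)" by simp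
    then show ?thesis
      by (rule has_field_derivative_transform_within_open[of _ _ _ "{..<0}"]) (use t in auto)
  qed
  from has_derivative_compose[OF assms(1) this[OF assms(2), unfolded has_field_derivative_def]]
  show ?thesis .
qed

lemma partial_abs_powr_mult:
  assumes "g differentiable (at x)" "h differentiable (at x)" "g x \<noteq> 0" "h x \<noteq> 0"
  shows "partial l (\<lambda>z. \<bar>g z\<bar> powr s * \<bar>h z\<bar> powr t) x =
    \<bar>g x\<bar> powr s * \<bar>h x\<bar> powr t * (s * partial l g x / g x + t * partial l h x / h x)"
  by (subst partial_eqI[OF has_derivative_mult[OF
        has_derivative_abs_powr[OF assms(1)[unfolded frechet_derivative_works] assms(3)]
        has_derivative_abs_powr[OF assms(2)[unfolded frechet_derivative_works] assms(4)]]])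
    (simp add: partial_def algebra_simps)

context kropina_field
begin

text \<open>Both sides are compared through logarithmic derivatives. Passing from base to fibre
  derivatives leaves the error 2 m f_l for the quadratic form and (1 + m) f_l for the linear one,
  and the powers 1 + m and -2 m weight these errors to a total of zero.\<close>

lemma horizontal_kropina:
  assumes x: "x \<in> X"
    and Q: "(\<Sum>i\<in>UNIV. \<Sum>j\<in>UNIV. a x $ i $ j * y $ i * y $ j) \<noteq> 0" (is "?Q x y \<noteq> 0")
    and \<beta>: "(\<Sum>i\<in>UNIV. b x $ i * y $ i) \<noteq> 0" (is "?\<beta> x y \<noteq> 0")
  shows "partial l (\<lambda>z. \<bar>?Q z y\<bar> powr (1 + m) * \<bar>?\<beta> z y\<bar> powr (- 2 * m)) x =
    (\<Sum>k\<in>UNIV. (\<Sum>p\<in>UNIV. \<Gamma> x k l p * y $ p) *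
      partial k (\<lambda>w. \<bar>?Q x w\<bar> powr (1 + m) * \<bar>?\<beta> x w\<bar> powr (- 2 * m)) y)"
proof -
  define N where "N k = (\<Sum>p\<in>UNIV. \<Gamma> x k l p * y $ p)" for k
  have dQ: "(\<lambda>z. ?Q z y) differentiable (at x)" "(\<lambda>w. ?Q x w) differentiable (at y)"
    "(\<lambda>z. ?\<beta> z y) differentiable (at x)" "(\<lambda>w. ?\<beta> x w) differentiable (at y)"
    by (simp_all add: diff[OF x] diff_b[OF x] differentiable_mult differentiable_coordinate)
  have Qk: "partial k (\<lambda>w. ?Q x w) y = 2 * (\<Sum>j\<in>UNIV. a x $ k $ j * y $ j)" for k
  proof -
    have "partial k (\<lambda>w. ?Q x w) y = (\<Sum>i\<in>UNIV. \<Sum>j\<in>UNIV.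
      (if k = i then a x $ i $ j * y $ j else 0) + (if k = j then a x $ j $ i * y $ i else 0))"
      by (simp add: partial_sum partial_mult differentiable_mult differentiable_coordinate
        partial_coordinate partial_const sym[OF x, of _ k] if_distrib cong: if_cong)
        (auto intro!: sum.cong simp: sym[OF x])
    also have "\<dots> = (\<Sum>i\<in>UNIV. \<Sum>j\<in>UNIV. if k = i then a x $ i $ j * y $ j else 0) +
        (\<Sum>i\<in>UNIV. \<Sum>j\<in>UNIV. if k = j then a x $ j $ i * y $ i else 0)"
      by (simp add: sum.distrib)
    also have "(\<Sum>i\<in>UNIV. \<Sum>j\<in>UNIV. if k = i then a x $ i $ j * y $ j else 0) = (\<Sum>j\<in>UNIV. a x $ k $ j * y $ j)"
      by (subst sum.swap) simp
    finally show ?thesis by simp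
  qed
  have \<beta>k: "partial k (\<lambda>w. ?\<beta> x w) y = b x $ k" for k
    by (simp add: partial_sum partial_mult differentiable_mult differentiable_coordinate
        partial_coordinate partial_const if_distrib cong: if_cong)
  have Ql: "partial l (\<lambda>z. ?Q z y) x = (\<Sum>k\<in>UNIV. N k * partial k (\<lambda>w. ?Q x w) y) + 2 * m * f x $ l * ?Q x y"
  proof -
    have "(\<Sum>i\<in>UNIV. \<Sum>j\<in>UNIV. (\<Sum>k\<in>UNIV. a x $ i $ k * \<Gamma> x k l j) * y $ i * y $ j) =
       (\<Sum>i\<in>UNIV. \<Sum>k\<in>UNIV. a x $ i $ k * y $ i * N k)"
    proof (rule sum.cong[OF refl])
      fix i
      have "(\<Sum>j\<in>UNIV. (\<Sum>k\<in>UNIV. a x $ i $ k * \<Gamma> x k l j) * y $ i * y $ j) =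
        (\<Sum>j\<in>UNIV. \<Sum>k\<in>UNIV. a x $ i $ k * y $ i * (\<Gamma> x k l j * y $ j))"
        by (simp add: sum_distrib_left sum_distrib_right mult_ac)
      also have "\<dots> = (\<Sum>k\<in>UNIV. a x $ i $ k * y $ i * N k)"
        unfolding N_def by (subst sum.swap) (simp add: sum_distrib_left)
      finally show "(\<Sum>j\<in>UNIV. (\<Sum>k\<in>UNIV. a x $ i $ k * \<Gamma> x k l j) * y $ i * y $ j) =
        (\<Sum>k\<in>UNIV. a x $ i $ k * y $ i * N k)" .
    qed
    also have "\<dots> = (\<Sum>k\<in>UNIV. N k * (\<Sum>j\<in>UNIV. a x $ k $ j * y $ j))"
    proof (subst sum.swap, rule sum.cong[OF refl])
      fix k
      show "(\<Sum>i\<in>UNIV. a x $ i $ k * y $ i * N k) = N k * (\<Sum>j\<in>UNIV. a x $ k $ j * y $ j)"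
        by (simp add: sum_distrib_left sym[OF x, of _ k] mult_ac)
    qed
    finally have 1: "(\<Sum>i\<in>UNIV. \<Sum>j\<in>UNIV. (\<Sum>k\<in>UNIV. a x $ i $ k * \<Gamma> x k l j) * y $ i * y $ j) =
      (\<Sum>k\<in>UNIV. N k * (\<Sum>j\<in>UNIV. a x $ k $ j * y $ j))" .
    have "(\<Sum>i\<in>UNIV. \<Sum>j\<in>UNIV. (\<Sum>k\<in>UNIV. a x $ j $ k * \<Gamma> x k l i) * y $ i * y $ j) =
      (\<Sum>i\<in>UNIV. \<Sum>j\<in>UNIV. (\<Sum>k\<in>UNIV. a x $ i $ k * \<Gamma> x k l j) * y $ i * y $ j)"
      by (subst sum.swap) (simp add: mult_ac)
    note 2 = this[unfolded 1]
    have "partial l (\<lambda>z. ?Q z y) x = (\<Sum>i\<in>UNIV. \<Sum>j\<in>UNIV. partial l (\<lambda>z. a z $ i $ j) x * y $ i * y $ j)"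
      by (simp add: partial_sum partial_mult differentiable_mult diff[OF x] partial_const)
    also have "\<dots> = (\<Sum>i\<in>UNIV. \<Sum>j\<in>UNIV. (\<Sum>k\<in>UNIV. a x $ j $ k * \<Gamma> x k l i) * y $ i * y $ j)
      + (\<Sum>i\<in>UNIV. \<Sum>j\<in>UNIV. (\<Sum>k\<in>UNIV. a x $ i $ k * \<Gamma> x k l j) * y $ i * y $ j)
      + (\<Sum>i\<in>UNIV. \<Sum>j\<in>UNIV. 2 * m * f x $ l * (a x $ i $ j * y $ i * y $ j))"
      unfolding partial_metric_connection[OF x]
      by (simp only: distrib_right sum.distrib mult.assoc)
    also have "(\<Sum>i\<in>UNIV. \<Sum>j\<in>UNIV. 2 * m * f x $ l * (a x $ i $ j * y $ i * y $ j)) = 2 * m * f x $ l * ?Q x y"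
      by (simp only: sum_distrib_left)
    moreover have "(\<Sum>k\<in>UNIV. N k * partial k (\<lambda>w. ?Q x w) y) = 2 * (\<Sum>k\<in>UNIV. N k * (\<Sum>j\<in>UNIV. a x $ k $ j * y $ j))"
      unfolding Qk by (simp add: sum_distrib_left mult_ac)
    ultimately show ?thesis unfolding 1 2 by simp
  qed
  have \<beta>l: "partial l (\<lambda>z. ?\<beta> z y) x = (\<Sum>k\<in>UNIV. N k * partial k (\<lambda>w. ?\<beta> x w) y) + (1 + m) * f x $ l * ?\<beta> x y"
  proof -
    have "partial l (\<lambda>z. ?\<beta> z y) x = (\<Sum>i\<in>UNIV. \<Sum>k\<in>UNIV. b x $ k * \<Gamma> x k l i * y $ i)
        + (\<Sum>i\<in>UNIV. (1 + m) * f x $ l * (b x $ i * y $ i))"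
      by (simp add: partial_sum partial_mult differentiable_mult diff_b[OF x] partial_const
        partial_form_connection[OF x] distrib_right sum.distrib sum_distrib_right mult.assoc)
    also have "(\<Sum>i\<in>UNIV. \<Sum>k\<in>UNIV. b x $ k * \<Gamma> x k l i * y $ i) = (\<Sum>k\<in>UNIV. N k * b x $ k)"
      unfolding N_def by (subst sum.swap) (simp add: sum_distrib_left sum_distrib_right mult_ac)
    finally show ?thesis unfolding \<beta>k by (simp only: sum_distrib_left)
  qed
  let ?E = "\<bar>?Q x y\<bar> powr (1 + m) * \<bar>?\<beta> x y\<bar> powr (- 2 * m)"
  have "(\<Sum>k\<in>UNIV. N k * (?E * ((1 + m) * partial k (\<lambda>w. ?Q x w) y / ?Q x y
      + (- 2 * m) * partial k (\<lambda>w. ?\<beta> x w) y / ?\<beta> x y))) =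
    (\<Sum>k\<in>UNIV. ?E * (1 + m) / ?Q x y * (N k * partial k (\<lambda>w. ?Q x w) y)
        + ?E * (- 2 * m) / ?\<beta> x y * (N k * partial k (\<lambda>w. ?\<beta> x w) y))"
    by (intro sum.cong refl) (simp add: algebra_simps)
  also have "\<dots> = ?E * (1 + m) / ?Q x y * (\<Sum>k\<in>UNIV. N k * partial k (\<lambda>w. ?Q x w) y)
        + ?E * (- 2 * m) / ?\<beta> x y * (\<Sum>k\<in>UNIV. N k * partial k (\<lambda>w. ?\<beta> x w) y)"
    by (simp only: sum.distrib sum_distrib_left[symmetric])
  also have "\<dots> = ?E * (1 + m) / ?Q x y * (partial l (\<lambda>z. ?Q z y) x - 2 * m * f x $ l * ?Q x y)
        + ?E * (- 2 * m) / ?\<beta> x y * (partial l (\<lambda>z. ?\<beta> z y) x - (1 + m) * f x $ l * ?\<beta> x y)"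
    unfolding Ql \<beta>l by (simp only: add_diff_cancel_right')
  also have "\<dots> = ?E * ((1 + m) * partial l (\<lambda>z. ?Q z y) x / ?Q x y
      + (- 2 * m) * partial l (\<lambda>z. ?\<beta> z y) x / ?\<beta> x y)"
  proof -
    \<comment> \<open>Here \<open>s\<close> stands for 1 + m and \<open>c\<close> for f_l: the two
      summands contribute -2 m s c E and +2 m s c E.\<close>
    have "E * s / q * (dq - 2 * m * c * q) + E * (- 2 * m) / r * (dr - s * c * r) =
      E * (s * dq / q + (- 2 * m) * dr / r)" if "q \<noteq> 0" "r \<noteq> 0" for E s q r c dq dr :: real
      using that by (simp add: field_simps)
    from this[OF Q \<beta>] show ?thesis .
  qed
  finally show ?thesis
    unfolding partial_abs_powr_mult[OF dQ(1,3) Q \<beta>] partial_abs_powr_mult[OF dQ(2,4) Q \<beta>] N_def ..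
qed

end

section \<open>Charts and tangent vectors\<close>

locale smooth_atlas =
  fixes M :: "('p::{t2_space, second_countable_topology}, 'n::finite) chart set"
  assumes smooth_M: "smooth_manifold M"
begin

lemma chart_cover: obtains c where "c \<in> M" "p \<in> fst c"
  using smooth_M unfolding smooth_manifold_def by blast

lemma chart_homeomorphism:
  "c \<in> M \<Longrightarrow> homeomorphism (fst c) (coord_image c UNIV) (snd c) (chart_inv c)"
  using smooth_M unfolding smooth_manifold_def by blast

lemma open_chart: "c \<in> M \<Longrightarrow> open (fst c)"
  using smooth_M unfolding smooth_manifold_def by blast

lemma open_coords: "c \<in> M \<Longrightarrow> open (coord_image c UNIV)"
  using smooth_M unfolding smooth_manifold_def by blast

lemma chart_inv_apply: "c \<in> M \<Longrightarrow> p \<in> fst c \<Longrightarrow> chart_inv c (snd c p) = p"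
  using chart_homeomorphism by (rule homeomorphism_apply1)

lemma chart_apply_inv: "c \<in> M \<Longrightarrow> x \<in> coord_image c UNIV \<Longrightarrow> snd c (chart_inv c x) = x"
  using chart_homeomorphism by (rule homeomorphism_apply2)

lemma chart_inv_mem: "c \<in> M \<Longrightarrow> x \<in> coord_image c UNIV \<Longrightarrow> chart_inv c x \<in> fst c"
  using homeomorphism_image2[OF chart_homeomorphism] by blast

lemma chart_mem: "p \<in> fst c \<Longrightarrow> p \<in> U \<Longrightarrow> snd c p \<in> coord_image c U"
  by (auto simp: coord_image_def)

lemma coord_image_mono: "x \<in> coord_image c U \<Longrightarrow> x \<in> coord_image c UNIV"
  by (auto simp: coord_image_def)

lemma coord_image_iff:
  "c \<in> M \<Longrightarrow> x \<in> coord_image c U \<longleftrightarrow> x \<in> coord_image c UNIV \<and> chart_inv c x \<in> U"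
  using chart_inv_apply by (fastforce simp: coord_image_def)

lemma open_coord_image:
  assumes "c \<in> M" "open U"
  shows "open (coord_image c U)"
proof -
  have "open (coord_image c UNIV \<inter> chart_inv c -` U)"
    using homeomorphism_cont2[OF chart_homeomorphism[OF assms(1)]] open_coords[OF assms(1)] assms(2)
    by (rule continuous_open_preimage)
  moreover have "coord_image c U = coord_image c UNIV \<inter> chart_inv c -` U"
    using coord_image_iff[OF assms(1)] by auto
  ultimately show ?thesis by simp
qed

lemma coord_change_inv:
  assumes "c' \<in> M" "x \<in> coord_image c (fst c')" "c \<in> M"
  shows "chart_inv c' (coord_change c c' x) = chart_inv c x"
  using assms coord_image_iff[of c x "fst c'"] by (simp add: coord_change_def chart_inv_apply)

lemma coord_change_mem:
  assumes "c' \<in> M" "x \<in> coord_image c (fst c')" "c \<in> M" "chart_inv c x \<in> U"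
  shows "coord_change c c' x \<in> coord_image c' U"
  using assms coord_image_iff[of c x "fst c'"] by (auto simp: coord_change_def intro!: chart_mem)

lemma coord_change_derivative:
  assumes "c \<in> M" "c' \<in> M" "x \<in> coord_image c (fst c')"
  shows "(coord_change c c' has_derivative frechet_derivative (coord_change c c') (at x)) (at x)"
  using assms smooth_M smooth_on_differentiable
  unfolding smooth_manifold_def frechet_derivative_works[symmetric] by blast

lemma coord_change_cocycle:
  assumes c: "c \<in> M" "c' \<in> M" "c'' \<in> M" and x: "x \<in> coord_image c (fst c')" "x \<in> coord_image c (fst c'')"
  shows "frechet_derivative (coord_change c c'') (at x) y =
    frechet_derivative (coord_change c' c'') (at (coord_change c c' x))
      (frechet_derivative (coord_change c c') (at x) y)"
proof -
  have "chart_inv c x \<in> fst c''" using coord_image_iff[OF c(1)] x by blast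
  then have "coord_change c c' x \<in> coord_image c' (fst c'')"
    by (rule coord_change_mem[OF c(2) x(1) c(1)])
  from has_derivative_compose[OF coord_change_derivative[OF c(1,2) x(1)] coord_change_derivative[OF c(2,3) this]]
  have "((\<lambda>z. coord_change c' c'' (coord_change c c' z)) has_derivative
    (\<lambda>y. frechet_derivative (coord_change c' c'') (at (coord_change c c' x))
      (frechet_derivative (coord_change c c') (at x) y))) (at x)" .
  then have "(coord_change c c'' has_derivative
    (\<lambda>y. frechet_derivative (coord_change c' c'') (at (coord_change c c' x))
      (frechet_derivative (coord_change c c') (at x) y))) (at x)"
  proof (rule has_derivative_transform_within_open)
    show "open (coord_image c (fst c'))" using c open_chart open_coord_image by blast
    fix z assume "z \<in> coord_image c (fst c')"
    then show "coord_change c' c'' (coord_change c c' z) = coord_change c c'' z"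
      using coord_change_inv[OF c(2) _ c(1)] by (simp add: coord_change_def[of _ c''])
  qed (rule x)
  from fun_cong[OF frechet_derivative_at[OF this], of y] show ?thesis by (rule sym)
qed

lemma coord_change_self:
  assumes "c \<in> M" "x \<in> coord_image c UNIV"
  shows "frechet_derivative (coord_change c c) (at x) y = y"
proof -
  have "(coord_change c c has_derivative (\<lambda>y. y)) (at x)"
    by (rule has_derivative_transform_within_open[OF has_derivative_ident open_coords[OF assms(1)] assms(2)])
      (simp add: coord_change_def chart_apply_inv[OF assms(1)])
  from fun_cong[OF frechet_derivative_at[OF this], of y] show ?thesis by (rule sym)
qed

lemma coord_vec_self:
  assumes "c \<in> M" "x \<in> coord_image c UNIV"
  shows "coord_vec M c x y c = y"
  using assms by (simp add: coord_vec_def coord_change_self chart_inv_mem)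

lemma coord_vec_tangent:
  assumes c: "c \<in> M" and x: "x \<in> coord_image c UNIV"
  shows "coord_vec M c x y \<in> tangent_space M (chart_inv c x)"
proof -
  have cocycle: "frechet_derivative (coord_change c c'') (at x) y =
      frechet_derivative (coord_change c' c'') (at (snd c' (chart_inv c x)))
        (frechet_derivative (coord_change c c') (at x) y)"
    if "c' \<in> M" "c'' \<in> M" "chart_inv c x \<in> fst c'" "chart_inv c x \<in> fst c''" for c' c''
  proof -
    have "x \<in> coord_image c (fst c')" "x \<in> coord_image c (fst c'')"
      using that coord_image_iff[OF c] x by blast+
    moreover have "coord_change c c' x = snd c' (chart_inv c x)" by (simp add: coord_change_def)
    ultimately show ?thesis using coord_change_cocycle[OF c that(1,2)] by metis
  qed
  show ?thesis
    unfolding tangent_space_def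
  proof (intro CollectI conjI ballI allI impI)
    fix c' c'' assume c': "c' \<in> M" "c'' \<in> M" "chart_inv c x \<in> fst c' \<inter> fst c''"
    then show "coord_vec M c x y c'' = frechet_derivative (coord_change c' c'') (at (snd c' (chart_inv c x)))
        (coord_vec M c x y c')"
      using cocycle[of c' c''] by (simp add: coord_vec_def)
  qed (auto simp: coord_vec_def)
qed

text \<open>With \<open>coord_vec_tangent\<close> this identifies the tangent space with R^n through
  one chart. Equality as functions on all charts relies on the default value 0 outside the charts
  around the point.\<close>

lemma tangent_coord_vec:
  assumes c: "c \<in> M" and x: "x \<in> coord_image c UNIV" and v: "v \<in> tangent_space M (chart_inv c x)"
  shows "v = coord_vec M c x (v c)"
proof
  fix c'
  show "v c' = coord_vec M c x (v c) c'"
  proof (cases "c' \<in> M \<and> chart_inv c x \<in> fst c'")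
    case True
    then have "v c' = frechet_derivative (coord_change c c') (at (snd c (chart_inv c x))) (v c)"
      using v c chart_inv_mem[OF c x] unfolding tangent_space_def by blast
    then show ?thesis using True by (simp add: coord_vec_def chart_apply_inv[OF c x])
  next
    case False
    then have "v c' = 0" using v unfolding tangent_space_def by blast
    moreover have "coord_vec M c x (v c) c' = 0" unfolding coord_vec_def using False by (rule if_not_P)
    ultimately show ?thesis by simp
  qed
qed

lemma coord_vec_change:
  assumes c: "c \<in> M" "c' \<in> M" and x: "x \<in> coord_image c (fst c')"
  shows "coord_vec M c x y = coord_vec M c' (coord_change c c' x) (frechet_derivative (coord_change c c') (at x) y)"
proof -
  have x': "chart_inv c x \<in> fst c'" "x \<in> coord_image c UNIV" using coord_image_iff[OF c(1)] x by blast+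
  have "coord_change c c' x \<in> coord_image c' UNIV" by (rule coord_change_mem[OF c(2) x c(1)]) simp
  from tangent_coord_vec[OF c(2) this, unfolded coord_change_inv[OF c(2) x c(1)], OF coord_vec_tangent[OF c(1) x'(2)]]
  have "coord_vec M c x y = coord_vec M c' (coord_change c c' x) (coord_vec M c x y c')" .
  moreover have "coord_vec M c x y c' = frechet_derivative (coord_change c c') (at x) y"
    using x' c by (simp add: coord_vec_def)
  ultimately show ?thesis by simp
qed

lemma coord_vec_linear:
  assumes c: "c \<in> M" and x: "x \<in> coord_image c UNIV"
  shows "coord_vec M c x (s *\<^sub>R y + t *\<^sub>R z) = (\<lambda>c'. s *\<^sub>R coord_vec M c x y c' + t *\<^sub>R coord_vec M c x z c')"
proof
  fix c'
  show "coord_vec M c x (s *\<^sub>R y + t *\<^sub>R z) c' = s *\<^sub>R coord_vec M c x y c' + t *\<^sub>R coord_vec M c x z c'"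
  proof (cases "c' \<in> M \<and> chart_inv c x \<in> fst c'")
    case True
    then have "x \<in> coord_image c (fst c')" using coord_image_iff[OF c] x by blast
    then have "linear (frechet_derivative (coord_change c c') (at x))"
      using coord_change_derivative[OF c] True has_derivative_linear by blast
    then show ?thesis using True by (simp add: coord_vec_def linear_add linear_cmul)
  qed (auto simp: coord_vec_def)
qed

lemma linear_coord_vec:
  assumes c: "c \<in> M" and x: "x \<in> coord_image c UNIV"
    and lin: "\<And>u v s t. u \<in> tangent_space M (chart_inv c x) \<Longrightarrow> v \<in> tangent_space M (chart_inv c x) \<Longrightarrow>
      b (\<lambda>c. s *\<^sub>R u c + t *\<^sub>R v c) = s * b u + t * (b v :: real)"
  shows "linear (\<lambda>y. b (coord_vec M c x y))"
proof (rule linearI)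
  fix y z :: "real^'n" and s :: real
  have *: "b (coord_vec M c x (s *\<^sub>R y + t *\<^sub>R z)) = s * b (coord_vec M c x y) + t * b (coord_vec M c x z)" for s t y z
    unfolding coord_vec_linear[OF c x] by (intro lin coord_vec_tangent c x)
  show "b (coord_vec M c x (y + z)) = b (coord_vec M c x y) + b (coord_vec M c x z)"
    using *[of 1 y 1 z] by simp
  show "b (coord_vec M c x (s *\<^sub>R y)) = s *\<^sub>R b (coord_vec M c x y)"
    using *[of s y 0 0] by simp
qed

lemma form_expansion:
  assumes "one_form_on M U b" and c: "c \<in> M" and x: "x \<in> coord_image c U"
  shows "b (chart_inv c x) (coord_vec M c x y) = (\<Sum>i\<in>UNIV. form_comp M c b x $ i * y $ i)"
proof -
  have "chart_inv c x \<in> U" using coord_image_iff[OF c] x by blast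
  then have lin: "linear (\<lambda>y. b (chart_inv c x) (coord_vec M c x y))"
    using assms(1) unfolding one_form_on_def
    by (intro linear_coord_vec c coord_image_mono[OF x]) blast
  have "b (chart_inv c x) (coord_vec M c x y) = (\<Sum>i\<in>UNIV. y $ i * b (chart_inv c x) (coord_vec M c x (axis i 1)))"
    by (rule linear_axis_expansion[OF lin])
  also have "\<dots> = (\<Sum>i\<in>UNIV. form_comp M c b x $ i * y $ i)"
    by (simp add: form_comp_def mult.commute)
  finally show ?thesis .
qed

lemma metric_expansion:
  assumes g: "metric_on M U g" and c: "c \<in> M" and x: "x \<in> coord_image c U"
  shows "g (chart_inv c x) (coord_vec M c x y) (coord_vec M c x z) =
    (\<Sum>i\<in>UNIV. \<Sum>j\<in>UNIV. metric_comp M c g x $ i $ j * y $ i * z $ j)"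
proof -
  let ?p = "chart_inv c x" and ?v = "coord_vec M c x"
  have p: "?p \<in> U" using coord_image_iff[OF c] x by blast
  note x' = coord_image_mono[OF x]
  have 1: "linear (\<lambda>y. g ?p (?v y) (?v z))" for z
    using g p coord_vec_tangent[OF c x'] unfolding metric_on_def
    by (intro linear_coord_vec[where b = "\<lambda>u. g ?p u (?v z)"] c x') blast
  have s: "g ?p (?v y) (?v z) = g ?p (?v z) (?v y)" for y z
    using g p coord_vec_tangent[OF c x'] unfolding metric_on_def by blast
  \<comment> \<open>\<open>metric_on\<close> states linearity in the first slot; symmetry transfers
    it to the second.\<close>
  have 2: "linear (\<lambda>z. g ?p (?v y) (?v z))" for y
  proof -
    have "(\<lambda>z. g ?p (?v y) (?v z)) = (\<lambda>z. g ?p (?v z) (?v y))" by (rule ext) (rule s)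
    then show ?thesis using 1 by simp
  qed
  have "g ?p (?v y) (?v z) = (\<Sum>i\<in>UNIV. y $ i * g ?p (?v (axis i 1)) (?v z))"
    by (rule linear_axis_expansion[OF 1])
  also have "\<dots> = (\<Sum>i\<in>UNIV. y $ i * (\<Sum>j\<in>UNIV. z $ j * g ?p (?v (axis i 1)) (?v (axis j 1))))"
    by (intro sum.cong refl arg_cong[where f = "(*) _"] linear_axis_expansion[OF 2])
  finally show ?thesis by (simp add: metric_comp_def sum_distrib_left mult_ac)
qed

lemma metric_field_comp:
  assumes g: "metric_on M U g" and c: "c \<in> M" and "open U"
  shows "metric_field (coord_image c U) (metric_comp M c g)"
proof
  show "open (coord_image c U)" using open_coord_image c assms(3) by blast
  show "smooth_on (coord_image c U) (\<lambda>x. metric_comp M c g x $ i $ j)" for i j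
    using g c unfolding metric_on_def by blast
  fix x assume x: "x \<in> coord_image c U"
  let ?p = "chart_inv c x" and ?v = "coord_vec M c x"
  have p: "?p \<in> U" using coord_image_iff[OF c] x by blast
  note x' = coord_image_mono[OF x]
  show s: "metric_comp M c g x $ i $ j = metric_comp M c g x $ j $ i" for i j
    using g p coord_vec_tangent[OF c x'] unfolding metric_on_def by (simp add: metric_comp_def)
  \<comment> \<open>A vector in the kernel of the component matrix is orthogonal to every tangent
    vector, so nondegeneracy makes it vanish. A trivial kernel gives invertibility.\<close>
  have "y = 0" if y: "metric_comp M c g x *v y = 0" for y
  proof -
    have y': "(\<Sum>i\<in>UNIV. metric_comp M c g x $ i $ j * y $ i) = 0" for j
      using arg_cong[OF y, of "\<lambda>v. v $ j"] by (simp add: matrix_vector_mult_def s[of j])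
    have "g ?p (?v y) (?v z) = 0" for z
    proof -
      have "g ?p (?v y) (?v z) = (\<Sum>j\<in>UNIV. (\<Sum>i\<in>UNIV. metric_comp M c g x $ i $ j * y $ i) * z $ j)"
        unfolding metric_expansion[OF g c x] by (subst sum.swap) (simp add: sum_distrib_right)
      then show ?thesis by (simp add: y')
    qed
    then have "\<forall>w\<in>tangent_space M ?p. g ?p (?v y) w = 0"
      using tangent_coord_vec[OF c x'] by metis
    then have "?v y = (\<lambda>_. 0)"
      using g p coord_vec_tangent[OF c x'] unfolding metric_on_def by blast
    then show ?thesis using coord_vec_self[OF c x', of y] by simp
  qed
  then show "invertible (metric_comp M c g x)"
    unfolding invertible_left_inverse matrix_left_invertible_ker by blast
qed

text \<open>The Poincare lemma gives a potential in one chart around \<open>p\<close>. In any other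
  chart the chain rule turns its differential into \<open>f\<close> on coordinate vectors, since
  both transform by the derivative of the coordinate change.\<close>

lemma form_potential:
  assumes f: "one_form_on M UNIV f" and closed: "closed_form M f"
  shows "\<exists>U \<psi>. open U \<and> p \<in> U \<and> potential_on M U f \<psi>"
proof -
  obtain c where c: "c \<in> M" "p \<in> fst c" by (rule chart_cover)
  have "snd c p \<in> coord_image c UNIV" using c by (auto intro: chart_mem)
  then obtain r where r: "r > 0" "ball (snd c p) r \<subseteq> coord_image c UNIV"
    using open_coords[OF c(1)] unfolding open_contains_ball by blast
  let ?B = "ball (snd c p) r" and ?w = "form_comp M c f"
  have "\<exists>\<psi>. \<forall>x\<in>?B. (\<psi> has_derivative (\<lambda>v. ?w x \<bullet> v)) (at x)"
  proof (rule closed_field_potential[of "snd c p" r ?w])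
    show "smooth_on ?B (\<lambda>x. ?w x $ i)" for i
      using f c r(2) unfolding one_form_on_def by (blast intro: smooth_on_subset)
    show "partial i (\<lambda>z. ?w z $ j) x = partial j (\<lambda>z. ?w z $ i) x" if "x \<in> ?B" for x i j
      using closed c r(2) that unfolding closed_form_def by blast
  qed blast
  then obtain \<psi> where \<psi>: "\<And>x. x \<in> ?B \<Longrightarrow> (\<psi> has_derivative (\<lambda>v. ?w x \<bullet> v)) (at x)"
    by blast
  define U where "U = fst c \<inter> snd c -` ?B"
  have "open U"
    unfolding U_def using homeomorphism_cont1[OF chart_homeomorphism[OF c(1)]] open_chart[OF c(1)]
    by (intro continuous_open_preimage) auto
  moreover have "p \<in> U" using c r by (simp add: U_def)
  moreover have "potential_on M U f (\<psi> \<circ> snd c)"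
  proof -
    have D: "((\<lambda>z. (\<psi> \<circ> snd c) (chart_inv c' z)) has_derivative
        (\<lambda>v. f (chart_inv c' x) (coord_vec M c' x v))) (at x)"
      if c': "c' \<in> M" and x: "x \<in> coord_image c' U" for c' x
    proof -
      let ?D = "frechet_derivative (coord_change c' c) (at x)"
      have xU: "x \<in> coord_image c' UNIV" "chart_inv c' x \<in> U" using coord_image_iff[OF c'] x by blast+
      have "chart_inv c' x \<in> fst c" using xU(2) by (simp add: U_def)
      then have xc: "x \<in> coord_image c' (fst c)" using coord_image_iff[OF c'] xU(1) by blast
      have B: "coord_change c' c x \<in> ?B" using xU by (simp add: U_def coord_change_def)
      have "((\<lambda>z. \<psi> (coord_change c' c z)) has_derivative (\<lambda>v. ?w (coord_change c' c x) \<bullet> ?D v)) (at x)"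
        by (rule has_derivative_compose[OF coord_change_derivative[OF c' c(1) xc] \<psi>[OF B]])
      moreover have "?w (coord_change c' c x) \<bullet> ?D v = f (chart_inv c' x) (coord_vec M c' x v)" for v
      proof -
        have "coord_change c' c x \<in> coord_image c UNIV" using B r(2) by blast
        from form_expansion[OF f c(1) this, of "?D v"]
        have "f (chart_inv c' x) (coord_vec M c (coord_change c' c x) (?D v)) = ?w (coord_change c' c x) \<bullet> ?D v"
          by (simp only: coord_change_inv[OF c(1) xc c'] inner_vec_def inner_real_def)
        then show ?thesis by (simp only: coord_vec_change[OF c' c(1) xc, of v])
      qed
      ultimately show ?thesis by (simp add: coord_change_def)
    qed
    have P: "partial i (\<lambda>z. (\<psi> \<circ> snd c) (chart_inv c' z)) x = form_comp M c' f x $ i"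
      if "c' \<in> M" and "x \<in> coord_image c' U" for c' x i
      using partial_eqI[OF D[OF that]] by (simp add: form_comp_def)
    have "smooth_on (coord_image c' U) (\<lambda>z. (\<psi> \<circ> snd c) (chart_inv c' z))" if c': "c' \<in> M" for c'
    proof (rule smooth_on_from_partials)
      show "smooth_on (coord_image c' U) (\<lambda>x. form_comp M c' f x $ i)" for i
        using f c' coord_image_mono unfolding one_form_on_def by (blast intro: smooth_on_subset)
      show "open (coord_image c' U)" using open_coord_image[OF c' \<open>open U\<close>] .
    qed (use D[OF c'] P[OF c'] in \<open>auto simp: differentiable_def\<close>)
    then show ?thesis using P by (simp add: potential_on_def smooth_fun_on_def)
  qed
  ultimately show ?thesis by blast
qed

end

section \<open>The affine connection of an m-Kropina metric\<close>

lemma ricci_cong: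
  assumes "open X" "x \<in> X" "\<And>z k i j. z \<in> X \<Longrightarrow> G z k i j = H z k i j"
  shows "ricci G x l k = ricci H x l k"
  unfolding ricci_def curvature_def
  by (intro sum.cong refl arg_cong2[where f = "(-)"] arg_cong2[where f = "(+)"]
      partial_cong[OF assms(1,2)] arg_cong2[where f = "(*)"] assms(3) assms(2))

lemma rpow_pos: "z > 0 \<Longrightarrow> rpow z s = z powr s"
  by (auto simp: rpow_def Ints_def powr_real_of_int' powr_of_int)

text \<open>An integer power of a negative number may carry a sign; squaring removes it, and both
  branches of \<open>rpow\<close> become a real power of the absolute value.\<close>

lemma rpow_square:
  assumes "z > 0 \<or> (s \<in> \<int> \<and> z \<noteq> 0)"
  shows "(rpow z s)\<^sup>2 = \<bar>z\<bar> powr (2 * s)"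
proof (cases "z > 0")
  case True
  then show ?thesis by (simp add: rpow_pos power2_eq_square flip: powr_add)
next
  case False
  then have s: "s \<in> \<int>" "z \<noteq> 0" using assms by auto
  then obtain k where k: "s = of_int k" by (auto simp: Ints_def)
  have "(rpow z s)\<^sup>2 = \<bar>z powi k\<bar>\<^sup>2" by (simp add: rpow_def k)
  also have "\<bar>z powi k\<bar> = \<bar>z\<bar> powr s" using s by (simp add: power_int_abs k powr_real_of_int')
  finally show ?thesis by (simp add: power2_eq_square flip: powr_add)
qed

lemma rpow_scale:
  assumes "t > 0" "z > 0 \<or> s \<in> \<int>"
  shows "rpow (t * z) s = t powr s * rpow z s"
proof (cases "s \<in> \<int>")
  case True
  then show ?thesis
    using assms(1) by (auto simp: rpow_def Ints_def power_int_mult_distrib powr_real_of_int')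
next
  case False
  then show ?thesis using assms by (simp add: rpow_def powr_mult)
qed

text \<open>Alpha scales by e^(-m psi) and beta by e^(-(1 + m) psi), so the exponents add up to -m
  (1 + m) psi + m (1 + m) psi = 0. This is pointwise in \<open>p\<close> and holds for every
  function \<open>\<psi>\<close>.\<close>

lemma kropina_fun_conformal:
  assumes "alpha a p v > 0" "b p v > 0 \<or> m \<in> \<int>"
  shows "kropina_fun m (\<lambda>p u v. exp (- 2 * m * \<psi> p) * a p u v) (\<lambda>p v. exp (- (1 + m) * \<psi> p) * b p v) p v =
    kropina_fun m a b p v"
proof -
  have "alpha (\<lambda>p u v. exp (- 2 * m * \<psi> p) * a p u v) p v = sqrt (exp (- m * \<psi> p) ^ 2) * alpha a p v"
    by (simp add: alpha_def abs_mult real_sqrt_mult flip: exp_double)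
  also have "\<dots> = exp (- m * \<psi> p) * alpha a p v" by simp
  finally have "kropina_fun m (\<lambda>p u v. exp (- 2 * m * \<psi> p) * a p u v) (\<lambda>p v. exp (- (1 + m) * \<psi> p) * b p v) p v =
     (exp (- m * \<psi> p) powr (1 + m) * exp (- (1 + m) * \<psi> p) powr (- m)) * kropina_fun m a b p v"
    using assms by (simp add: kropina_fun_def rpow_scale)
  also have "exp (- m * \<psi> p) powr (1 + m) * exp (- (1 + m) * \<psi> p) powr (- m) = 1"
    by (simp add: powr_def flip: exp_add) (simp add: algebra_simps)
  finally show ?thesis by simp
qed

section \<open>Identification of the affine connection on the manifold and the conformal
  change\<close>

context smooth_atlas
begin

lemma local_domain_nonempty:
  assumes A: "conic_subbundle M A" and c: "c \<in> M" and x: "x \<in> coord_image c UNIV"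
  obtains y where "(x, y) \<in> local_domain M c A"
proof -
  have "chart_inv c x \<in> fst ` A" using A by (simp add: conic_subbundle_def)
  then obtain v where v: "(chart_inv c x, v) \<in> A" by auto
  then have "v \<in> tangent_space M (chart_inv c x)"
    using A by (auto simp: conic_subbundle_def tangent_bundle_def)
  then have "v = coord_vec M c x (v c)" by (rule tangent_coord_vec[OF c x])
  then show ?thesis using v x that[of "v c"] by (simp add: local_domain_def)
qed

text \<open>Makes the choice in \<open>affine_connection\<close> harmless: two linear functions of
  \<open>y\<close> that agree on the nonempty open fibre of \<open>A\<close> have equal partial
  derivatives, that is, equal coefficients.\<close>

lemma connection_unique:
  assumes A: "conic_subbundle M A" and G: "is_affine_connection M A F G"
    and c: "c \<in> M" and x: "x \<in> coord_image c UNIV"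
    and H: "\<And>y k i. (x, y) \<in> local_domain M c A \<Longrightarrow>
      nonlinear_connection (local_fun M c F) x y k i = (\<Sum>j\<in>UNIV. H k i j * y $ j)"
  shows "G c x k i j = H k i j"
proof -
  let ?S = "{y. (x, y) \<in> local_domain M c A}"
  obtain y where y: "y \<in> ?S" using local_domain_nonempty[OF A c x] by blast
  have "open (local_domain M c A)" using A c by (simp add: conic_subbundle_def)
  then have "open ?S" by (rule open_slices)
  define h where "h u = (\<Sum>j\<in>UNIV. (G c x k i j - H k i j) * u $ j)" for u :: "real^'n"
  have "h u = 0" if "u \<in> ?S" for u
  proof -
    have u: "(x, u) \<in> local_domain M c A" using that by simp
    have "nonlinear_connection (local_fun M c F) x u k i = (\<Sum>j\<in>UNIV. G c x k i j * u $ j)"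
      using G c u unfolding is_affine_connection_def by blast
    with H[OF u] show ?thesis by (simp add: h_def left_diff_distrib sum_subtractf)
  qed
  then have "partial j h y = partial j (\<lambda>_. 0) y"
    by (intro partial_cong[OF \<open>open ?S\<close> y]) auto
  moreover have "partial j h y = G c x k i j - H k i j"
    unfolding h_def
    by (simp add: partial_sum partial_mult differentiable_mult differentiable_coordinate
        partial_coordinate partial_const if_distrib cong: if_cong)
  ultimately show ?thesis by (simp add: partial_const)
qed

lemma kropina_field_comp:
  assumes a: "metric_on M UNIV a" and b: "one_form_on M UNIV b" and f: "one_form_on M UNIV f"
    and "berwald_condition M m a b f" and c: "c \<in> M"
  shows "kropina_field (coord_image c UNIV) (metric_comp M c a) (form_comp M c b) (form_comp M c f) m"
proof -
  interpret metric_field "coord_image c UNIV" "metric_comp M c a"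
    by (rule metric_field_comp[OF a c open_UNIV])
  show ?thesis
    using b f assms(4) c unfolding one_form_on_def berwald_condition_def Let_def
    by unfold_locales blast+
qed

lemma local_kropina_square:
  assumes K: "kropina_metric M A m a b F" and c: "c \<in> M" and xy: "(x, y) \<in> local_domain M c A"
  defines "Q \<equiv> \<Sum>i\<in>UNIV. \<Sum>j\<in>UNIV. metric_comp M c a x $ i $ j * y $ i * y $ j"
    and "\<beta> \<equiv> \<Sum>i\<in>UNIV. form_comp M c b x $ i * y $ i"
  shows "Q \<noteq> 0" "\<beta> \<noteq> 0" "(local_fun M c F x y)\<^sup>2 = \<bar>Q\<bar> powr (1 + m) * \<bar>\<beta>\<bar> powr (- 2 * m)"
proof -
  let ?p = "chart_inv c x" and ?v = "coord_vec M c x y"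
  have x: "x \<in> coord_image c UNIV" and pv: "(?p, ?v) \<in> A" using xy by (auto simp: local_domain_def)
  have Q: "a ?p ?v ?v = Q"
    using K metric_expansion[OF _ c x] by (simp add: kropina_metric_def Q_def)
  have \<beta>: "b ?p ?v = \<beta>"
    using K form_expansion[OF _ c x] by (simp add: kropina_metric_def \<beta>_def)
  have *: "alpha a ?p ?v > 0" "b ?p ?v > 0 \<or> (m \<in> \<int> \<and> b ?p ?v \<noteq> 0)" "F ?p ?v = kropina_fun m a b ?p ?v"
    using K pv by (auto simp: kropina_metric_def)
  show "Q \<noteq> 0" using *(1) by (simp add: alpha_def Q)
  then have al: "alpha a ?p ?v > 0" "alpha a ?p ?v = \<bar>Q\<bar> powr (1 / 2)"
    by (simp_all add: alpha_def Q powr_half_sqrt)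
  show "\<beta> \<noteq> 0" using *(2) by (auto simp: \<beta>)
  have "(local_fun M c F x y)\<^sup>2 = (rpow (alpha a ?p ?v) (1 + m))\<^sup>2 * (rpow (b ?p ?v) (- m))\<^sup>2"
    by (simp add: local_fun_def *(3) kropina_fun_def power_mult_distrib)
  also have "\<dots> = \<bar>alpha a ?p ?v\<bar> powr (2 * (1 + m)) * \<bar>b ?p ?v\<bar> powr (2 * (- m))"
    using al(1) *(2) by (simp add: rpow_square)
  also have "\<bar>alpha a ?p ?v\<bar> powr (2 * (1 + m)) = \<bar>Q\<bar> powr (1 + m)"
    using al by (simp add: powr_powr add_divide_distrib)
  finally show "(local_fun M c F x y)\<^sup>2 = \<bar>Q\<bar> powr (1 + m) * \<bar>\<beta>\<bar> powr (- 2 * m)"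
    by (simp add: \<beta>)
qed

lemma kropina_nonlinear_connection:
  assumes K: "kropina_metric M A m a b F" and f: "one_form_on M UNIV f"
    and B: "berwald_condition M m a b f" and c: "c \<in> M" and xy: "(x, y) \<in> local_domain M c A"
  shows "nonlinear_connection (local_fun M c F) x y k i =
    (\<Sum>j\<in>UNIV. kropina_connection m (metric_comp M c a) (form_comp M c f) x k i j * y $ j)"
proof -
  interpret kropina_field "coord_image c UNIV" "metric_comp M c a" "form_comp M c b" "form_comp M c f" m
    using K f B c by (intro kropina_field_comp) (auto simp: kropina_metric_def)
  let ?D = "local_domain M c A"
  have x: "x \<in> coord_image c UNIV" using xy by (simp add: local_domain_def)
  have F: "finsler_metric M A F" using K by (simp add: kropina_metric_def)
  have D: "open ?D" using F c by (simp add: finsler_metric_def conic_subbundle_def)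
  note L = local_kropina_square[OF K c]
  show ?thesis
  proof (rule nonlinear_connection_horizontal[OF D])
    have "smooth_on ?D (\<lambda>(x, y). local_fun M c F x y)" using F c by (simp add: finsler_metric_def)
    from smooth_on_mult[OF D this this]
    show "smooth_on ?D (\<lambda>(x, y). (local_fun M c F x y)\<^sup>2)"
      by (simp add: power2_eq_square case_prod_unfold)
    show "\<Gamma> x k i j = \<Gamma> x k j i" for k i j by (rule connection_sym[OF x])
    show "invertible (fundamental_tensor (local_fun M c F) x u)" if "(x, u) \<in> ?D" for u
      using F c that unfolding finsler_metric_def by blast
    fix l u assume u: "(x, u) \<in> ?D"
    \<comment> \<open>The power formula for \<open>F^2\<close> is available only on
      \<open>A\<close>, so it is substituted under the derivative on an open slice of the domain,
      first in the base and later in the fibre direction.\<close>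
    have "partial l (\<lambda>z. (local_fun M c F z u)\<^sup>2) x = partial l (\<lambda>z.
      \<bar>\<Sum>i\<in>UNIV. \<Sum>j\<in>UNIV. metric_comp M c a z $ i $ j * u $ i * u $ j\<bar> powr (1 + m) *
      \<bar>\<Sum>i\<in>UNIV. form_comp M c b z $ i * u $ i\<bar> powr (- 2 * m)) x"
      by (rule partial_cong[OF open_slices(2)[OF D, of u]]) (use u L in auto)
    also have "\<dots> = (\<Sum>k\<in>UNIV. (\<Sum>p\<in>UNIV. \<Gamma> x k l p * u $ p) * partial k (\<lambda>w.
      \<bar>\<Sum>i\<in>UNIV. \<Sum>j\<in>UNIV. metric_comp M c a x $ i $ j * w $ i * w $ j\<bar> powr (1 + m) *
      \<bar>\<Sum>i\<in>UNIV. form_comp M c b x $ i * w $ i\<bar> powr (- 2 * m)) u)"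
      by (rule horizontal_kropina[OF x L(1,2)[OF u]])
    also have "\<dots> = (\<Sum>k\<in>UNIV. (\<Sum>p\<in>UNIV. \<Gamma> x k l p * u $ p) * partial k (\<lambda>w. (local_fun M c F x w)\<^sup>2) u)"
      by (intro sum.cong refl arg_cong[where f = "(*) _"] partial_cong[OF open_slices(1)[OF D, of x]])
        (use u L in auto)
    finally show "partial l (\<lambda>z. (local_fun M c F z u)\<^sup>2) x =
      (\<Sum>k\<in>UNIV. (\<Sum>p\<in>UNIV. \<Gamma> x k l p * u $ p) * partial k (\<lambda>w. (local_fun M c F x w)\<^sup>2) u)" .
  qed (rule xy)
qed

lemma affine_connection_kropina:
  assumes K: "kropina_metric M A m a b F" and "berwald_type M A F" and f: "one_form_on M UNIV f"
    and B: "berwald_condition M m a b f" and c: "c \<in> M" and x: "x \<in> coord_image c UNIV"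
  shows "affine_connection M A F c x k i j =
    kropina_connection m (metric_comp M c a) (form_comp M c f) x k i j"
proof (rule connection_unique[OF _ _ c x])
  show "conic_subbundle M A" using K by (simp add: kropina_metric_def finsler_metric_def)
  show "is_affine_connection M A F (affine_connection M A F)"
    using assms(2) unfolding berwald_type_def affine_connection_def by (rule someI_ex)
qed (rule kropina_nonlinear_connection[OF K f B c])

lemma ricci_symmetric_iff_closed:
  assumes K: "kropina_metric M A m a b F" and "berwald_type M A F" and f: "one_form_on M UNIV f"
    and B: "berwald_condition M m a b f" and "m \<noteq> 0"
  shows "ricci_symmetric M A F \<longleftrightarrow> closed_form M f"
proof -
  have "ricci (affine_connection M A F c) x i j = ricci (affine_connection M A F c) x j i \<longleftrightarrow>
    partial i (\<lambda>z. form_comp M c f z $ j) x = partial j (\<lambda>z. form_comp M c f z $ i) x"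
    if c: "c \<in> M" and x: "x \<in> coord_image c UNIV" for c x i j
  proof -
    interpret kropina_field "coord_image c UNIV" "metric_comp M c a" "form_comp M c b" "form_comp M c f" m
      using K f B c by (intro kropina_field_comp) (auto simp: kropina_metric_def)
    have "ricci (affine_connection M A F c) x i j = ricci \<Gamma> x i j" for i j
      by (rule ricci_cong[OF open_X x affine_connection_kropina[OF assms(1-4) c]])
    then show ?thesis using ricci_symmetric_iff[OF x \<open>m \<noteq> 0\<close>] by simp
  qed
  then show ?thesis unfolding ricci_symmetric_def closed_form_def by blast
qed

text \<open>Applies to every \<open>F\<close>, since only the local metrization enters. The
  coefficients agree with Levi-Civita ones on an open set, so their derivatives agree too, and the
  Levi-Civita trace is closed.\<close>

lemma locally_metrizable_imp_ricci_symmetric: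
  assumes "locally_metrizable M A F"
  shows "ricci_symmetric M A F"
  unfolding ricci_symmetric_def
proof (intro ballI allI)
  fix c x i j assume c: "c \<in> M" and x: "x \<in> coord_image c UNIV"
  obtain U g where U: "open U" "chart_inv c x \<in> U" "local_metrization M A F U g"
    using assms unfolding locally_metrizable_def by blast
  have xU: "x \<in> coord_image c U" using coord_image_iff[OF c] x U(2) by blast
  interpret metric_field "coord_image c U" "metric_comp M c g"
    using U c unfolding local_metrization_def by (intro metric_field_comp) auto
  have "ricci (affine_connection M A F c) x i j = ricci (christoffel (metric_comp M c g)) x i j" for i j
    using U(3) c by (intro ricci_cong[OF open_X xU]) (simp add: local_metrization_def)
  moreover have "ricci (christoffel (metric_comp M c g)) x i j - ricci (christoffel (metric_comp M c g)) x j i =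
      partial i (\<lambda>z. \<Sum>k\<in>UNIV. christoffel (metric_comp M c g) z k k j) x
      - partial j (\<lambda>z. \<Sum>k\<in>UNIV. christoffel (metric_comp M c g) z k k i) x"
    by (rule ricci_antisymmetric_part[OF open_X xU christoffel_sym christoffel_diff[OF xU]])
  moreover note christoffel_trace_closed[OF xU, of i j]
  ultimately show "ricci (affine_connection M A F c) x i j = ricci (affine_connection M A F c) x j i"
    by simp
qed

lemma metric_on_conformal:
  assumes a: "metric_on M UNIV a" and "open U" and \<psi>: "smooth_fun_on M U \<psi>"
  shows "metric_on M U (\<lambda>p u v. exp (r * \<psi> p) * a p u v)"
  unfolding metric_on_def
proof (intro conjI ballI allI impI)
  fix c i j assume c: "c \<in> M"
  have o: "open (coord_image c U)" by (rule open_coord_image[OF c \<open>open U\<close>])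
  have "smooth_on (coord_image c U) (\<lambda>x. exp (r * \<psi> (chart_inv c x)) * metric_comp M c a x $ i $ j)"
    using a c \<psi> coord_image_mono unfolding metric_on_def smooth_fun_on_def
    by (intro smooth_on_mult smooth_on_exp smooth_on_const o) (blast intro: smooth_on_subset)+
  then show "smooth_on (coord_image c U) (\<lambda>x. metric_comp M c (\<lambda>p u v. exp (r * \<psi> p) * a p u v) x $ i $ j)"
    by (simp add: metric_comp_def)
next
  fix p u v w and s t :: real
  assume "u \<in> tangent_space M p" "v \<in> tangent_space M p" "w \<in> tangent_space M p"
  then have "a p (\<lambda>c. s *\<^sub>R u c + t *\<^sub>R v c) w = s * a p u w + t * a p v w"
    using a unfolding metric_on_def by blast
  then show "exp (r * \<psi> p) * a p (\<lambda>c. s *\<^sub>R u c + t *\<^sub>R v c) w =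
      s * (exp (r * \<psi> p) * a p u w) + t * (exp (r * \<psi> p) * a p v w)"
    by (simp add: algebra_simps)
next
  fix p u v assume "u \<in> tangent_space M p" "v \<in> tangent_space M p"
  then have "a p u v = a p v u" using a unfolding metric_on_def by blast
  then show "exp (r * \<psi> p) * a p u v = exp (r * \<psi> p) * a p v u" by simp
next
  fix p u assume u: "u \<in> tangent_space M p" "\<forall>v\<in>tangent_space M p. exp (r * \<psi> p) * a p u v = 0"
  then have "\<forall>v\<in>tangent_space M p. a p u v = 0" by simp
  then show "u = (\<lambda>_. 0)" using a u(1) unfolding metric_on_def by blast
qed

lemma kropina_conformal:
  assumes K: "kropina_metric M A m a b F" and Bw: "berwald_type M A F" and f: "one_form_on M UNIV f"
    and B: "berwald_condition M m a b f" and U: "open U" and \<psi>: "potential_on M U f \<psi>"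
  defines "a' \<equiv> \<lambda>p u v. exp (- 2 * m * \<psi> p) * a p u v"
    and "b' \<equiv> \<lambda>p v. exp (- (1 + m) * \<psi> p) * b p v"
  shows "local_metrization M A F U a'" "parallel_on M U a' b'"
proof -
  have a: "metric_on M UNIV a" using K by (simp add: kropina_metric_def)
  have a': "metric_on M U a'"
    unfolding a'_def using \<psi> by (intro metric_on_conformal[OF a U]) (simp add: potential_on_def)
  have *: "christoffel (metric_comp M c a') x k i j = affine_connection M A F c x k i j \<and>
      cov_deriv (christoffel (metric_comp M c a')) (form_comp M c b') x j i = 0"
    if c: "c \<in> M" and x: "x \<in> coord_image c U" for c x k i j
  proof -
    interpret kropina_field "coord_image c UNIV" "metric_comp M c a" "form_comp M c b" "form_comp M c f" m
      using K f B c by (intro kropina_field_comp) (auto simp: kropina_metric_def)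
    let ?\<psi> = "\<lambda>z. \<psi> (chart_inv c z)"
    have x': "x \<in> coord_image c UNIV" by (rule coord_image_mono[OF x])
    have d: "?\<psi> differentiable (at x)"
      using \<psi> c x smooth_on_differentiable unfolding potential_on_def smooth_fun_on_def by blast
    have p: "partial i ?\<psi> x = form_comp M c f x $ i" for i
      using \<psi> c x unfolding potential_on_def by simp
    have chr: "christoffel (metric_comp M c a') x k i j = \<Gamma> x k i j" for k i j
      by (rule christoffel_conformal[OF metric_field_comp[OF a' c U] _ x _ d p])
        (auto simp: metric_comp_def a'_def dest: coord_image_mono)
    moreover have "cov_deriv (christoffel (metric_comp M c a')) (form_comp M c b') x j i = 0"
      by (rule cov_deriv_conformal[where b' = "form_comp M c b'" and \<psi> = ?\<psi>
          and G = "christoffel (metric_comp M c a')", OF x' open_coord_image[OF c U] x _ d p chr])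
        (simp add: form_comp_def b'_def)
    ultimately show ?thesis using affine_connection_kropina[OF K Bw f B c x'] by simp
  qed
  show "local_metrization M A F U a'" using a' * by (simp add: local_metrization_def)
  show "parallel_on M U a' b'" using * by (simp add: parallel_on_def)
qed

end

theorem theorem7:
  fixes M :: "('p::{t2_space, second_countable_topology}, 'n::finite) chart set"
    and A :: "('p \<times> ('p, 'n) tvec) set"
    and F :: "'p \<Rightarrow> ('p, 'n) tvec \<Rightarrow> real"
    and a :: "'p \<Rightarrow> ('p, 'n) tvec \<Rightarrow> ('p, 'n) tvec \<Rightarrow> real"
    and b f :: "'p \<Rightarrow> ('p, 'n) tvec \<Rightarrow> real"
    and m :: real
  assumes "smooth_manifold M"
    and "CARD('n) > 2"
    and "m \<noteq> 0"
    and "kropina_metric M A m a b F"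
    and "berwald_type M A F"
    and "one_form_on M UNIV f"
    and "berwald_condition M m a b f"
  shows "(locally_metrizable M A F \<longleftrightarrow> ricci_symmetric M A F) \<and>
    (ricci_symmetric M A F \<longleftrightarrow> closed_form M f) \<and>
    (closed_form M f \<longrightarrow>
      (\<forall>p. \<exists>U \<psi>. open U \<and> p \<in> U \<and> potential_on M U f \<psi>) \<and>
      (\<forall>U \<psi>. open U \<and> potential_on M U f \<psi> \<longrightarrow>
        (let a' = (\<lambda>p u v. exp (- 2 * m * \<psi> p) * a p u v);
             b' = (\<lambda>p v. exp (- (1 + m) * \<psi> p) * b p v)
         in (\<forall>(p, v)\<in>A. p \<in> U \<longrightarrow> F p v = kropina_fun m a' b' p v) \<and>
            parallel_on M U a' b' \<and>
            local_metrization M A F U a')))"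
proof -
  interpret smooth_atlas M by unfold_locales (rule assms(1))
  have iff: "ricci_symmetric M A F \<longleftrightarrow> closed_form M f"
    by (rule ricci_symmetric_iff_closed[OF assms(4-7,3)])
  have potential: "\<exists>U \<psi>. open U \<and> p \<in> U \<and> potential_on M U f \<psi>" if "closed_form M f" for p
    by (rule form_potential[OF assms(6) that])
  have "locally_metrizable M A F" if "closed_form M f"
    unfolding locally_metrizable_def using potential[OF that] kropina_conformal(1)[OF assms(4-7)] by meson
  moreover have "F p v = kropina_fun m (\<lambda>p u v. exp (- 2 * m * \<psi> p) * a p u v)
      (\<lambda>p v. exp (- (1 + m) * \<psi> p) * b p v) p v" if "(p, v) \<in> A" for p v \<psi>
    using assms(4) that kropina_fun_conformal[of a p v b m \<psi>] by (auto simp: kropina_metric_def)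
  \<comment> \<open>The cycle closes here: metrizability gives Ricci symmetry, this is equivalent to
    closedness of \<open>f\<close>, and closedness gives potentials whose conformal metrics are
    local metrizations.\<close>
  ultimately show ?thesis
    using iff potential locally_metrizable_imp_ricci_symmetric kropina_conformal[OF assms(4-7)]
    unfolding Let_def by auto
qed

end
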